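(* Let $(\Omega,\Sigma,\mu)$ be a probability measure space and $1\le p<\infty$. Then the inclusion map $i_{p}:L_{p^{*}}(\mu)\to L_{1}(\mu)$ is positively $p$-integral with $\widetilde i^{p}(i_{p})\le 1$.
   Context: All Banach spaces and Banach lattices are real; operators are bounded and linear. $p^{*}$ is the exponent conjugate to $p$. For a Banach lattice $X$, $X_+$ is the positive cone. For a Banach space $E$, $l_p(E)$ is the space of $p$-summable sequences with norm $\|(u_n)_n\|_p=(\sum_n\|u_n\|^p)^{1/p}$, and $l_p^w(E)$ is the space of weakly $p$-summable sequences with norm $\|(u_n)_n\|_p^w=\sup_{u^*\in B_{E^*}}(\sum_n|\langle u^*,u_n\rangle|^p)^{1/p}$ (usual modification for exponent $\infty$). $l_p^w(X)_+$ denotes the sequences in $l_p^w(X)$ with all terms in $X_+$. $x^*\otimes u$ is the operator $x\mapsto\langle x^*,x\rangle u$. Positively $p$-nuclear: $T:X\to E$ ($X$ a Banach lattice, $E$ a Banach space) is positively $p$-nuclear if $T=\sum_{j=1}^\infty x_j^*\otimes u_j$ with $(x_j^* )_j\in l^w_{p^*}(X^* )_+$ and $(u_j)_j\in l_p(E)$; $\widetilde\nu^p(T)=\inf\|(x_j^* )_j\|^w_{p^*}\|(u_j)_j\|_p$ over all such representations. Positively $p$-integral: $T:X\to E$ is positively $p$-integral if there is $C>0$ such that $\widetilde\nu^p(RTS)\le C\|R\|\|S\|$ for every Banach lattice $Y$, every Banach space $F$, every positive finite rank operator $S:Y\to X$ and every finite rank operator $R:E\to F$; $\widetilde i^p(T)$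 is the infimum of such $C$. *)

theory Defs
  imports "HOL-Probability.Probability"
begin

text \<open>
  The spaces \<open>L\<^sub>q(\<mu>)\<close> depend on a measure and on an exponent, so they cannot be types of a type
  class such as \<^class>\<open>banach\<close>.  Banach spaces and Banach lattices are therefore records with an
  explicit carrier.  Operators are functions whose values outside the carrier are irrelevant.
\<close>

record 'a nspace =
  vcar :: "'a set"
  vadd :: "'a \<Rightarrow> 'a \<Rightarrow> 'a"
  vzero :: "'a"
  vscale :: "real \<Rightarrow> 'a \<Rightarrow> 'a"
  vnorm :: "'a \<Rightarrow> real"

record 'a nlattice = "'a nspace" +
  vle :: "'a \<Rightarrow> 'a \<Rightarrow> bool"

definition vneg :: "('a, 'b) nspace_scheme \<Rightarrow> 'a \<Rightarrow> 'a" where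
  "vneg E x = vscale E (- 1) x"

definition vminus :: "('a, 'b) nspace_scheme \<Rightarrow> 'a \<Rightarrow> 'a \<Rightarrow> 'a" where
  "vminus E x y = vadd E x (vneg E y)"

locale banach_space =
  fixes E :: "('a, 'b) nspace_scheme"
  assumes zero_closed: "vzero E \<in> vcar E"
    and add_closed: "x \<in> vcar E \<Longrightarrow> y \<in> vcar E \<Longrightarrow> vadd E x y \<in> vcar E"
    and scale_closed: "x \<in> vcar E \<Longrightarrow> vscale E c x \<in> vcar E"
    and add_assoc: "x \<in> vcar E \<Longrightarrow> y \<in> vcar E \<Longrightarrow> z \<in> vcar E \<Longrightarrow>
      vadd E (vadd E x y) z = vadd E x (vadd E y z)"
    and add_comm: "x \<in> vcar E \<Longrightarrow> y \<in> vcar E \<Longrightarrow> vadd E x y = vadd E y x"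
    and add_zero: "x \<in> vcar E \<Longrightarrow> vadd E x (vzero E) = x"
    and add_neg: "x \<in> vcar E \<Longrightarrow> vadd E x (vneg E x) = vzero E"
    and scale_add_right: "x \<in> vcar E \<Longrightarrow> y \<in> vcar E \<Longrightarrow>
      vscale E c (vadd E x y) = vadd E (vscale E c x) (vscale E c y)"
    and scale_add_left: "x \<in> vcar E \<Longrightarrow>
      vscale E (c + d) x = vadd E (vscale E c x) (vscale E d x)"
    and scale_scale: "x \<in> vcar E \<Longrightarrow> vscale E c (vscale E d x) = vscale E (c * d) x"
    and scale_one: "x \<in> vcar E \<Longrightarrow> vscale E 1 x = x"
    and norm_nonneg: "x \<in> vcar E \<Longrightarrow> 0 \<le> vnorm E x"
    and norm_eq_zero: "x \<in> vcar E \<Longrightarrow> vnorm E x = 0 \<longleftrightarrow> x = vzero E"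
    and norm_scale: "x \<in> vcar E \<Longrightarrow> vnorm E (vscale E c x) = \<bar>c\<bar> * vnorm E x"
    and norm_triangle: "x \<in> vcar E \<Longrightarrow> y \<in> vcar E \<Longrightarrow>
      vnorm E (vadd E x y) \<le> vnorm E x + vnorm E y"
    and complete: "\<And>s :: nat \<Rightarrow> 'a. (\<And>n. s n \<in> vcar E) \<Longrightarrow>
      (\<And>e. 0 < e \<Longrightarrow> \<exists>N. \<forall>m\<ge>N. \<forall>n\<ge>N. vnorm E (vminus E (s m) (s n)) < e) \<Longrightarrow>
      \<exists>l\<in>vcar E. (\<lambda>n. vnorm E (vminus E (s n) l)) \<longlonglongrightarrow> 0"

definition vpos :: "('a, 'b) nlattice_scheme \<Rightarrow> 'a set" where
  "vpos X = {x \<in> vcar X. vle X (vzero X) x}"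

definition is_lub :: "('a, 'b) nlattice_scheme \<Rightarrow> 'a \<Rightarrow> 'a \<Rightarrow> 'a \<Rightarrow> bool" where
  "is_lub X x y z \<longleftrightarrow> z \<in> vcar X \<and> vle X x z \<and> vle X y z \<and>
     (\<forall>w\<in>vcar X. vle X x w \<longrightarrow> vle X y w \<longrightarrow> vle X z w)"

definition is_abs :: "('a, 'b) nlattice_scheme \<Rightarrow> 'a \<Rightarrow> 'a \<Rightarrow> bool" where
  "is_abs X x u \<longleftrightarrow> is_lub X x (vneg X x) u"

text \<open>Binary infima need not be required: they are \<open>x \<and> y = - ((- x) \<or> (- y))\<close>.\<close>

locale banach_lattice = banach_space X
  for X :: "('a, 'b) nlattice_scheme" +
  assumes le_refl: "x \<in> vcar X \<Longrightarrow> vle X x x"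
    and le_trans: "x \<in> vcar X \<Longrightarrow> y \<in> vcar X \<Longrightarrow> z \<in> vcar X \<Longrightarrow>
      vle X x y \<Longrightarrow> vle X y z \<Longrightarrow> vle X x z"
    and le_antisym: "x \<in> vcar X \<Longrightarrow> y \<in> vcar X \<Longrightarrow> vle X x y \<Longrightarrow> vle X y x \<Longrightarrow> x = y"
    and le_add: "x \<in> vcar X \<Longrightarrow> y \<in> vcar X \<Longrightarrow> z \<in> vcar X \<Longrightarrow> vle X x y \<Longrightarrow>
      vle X (vadd X x z) (vadd X y z)"
    and le_scale: "x \<in> vcar X \<Longrightarrow> y \<in> vcar X \<Longrightarrow> 0 \<le> c \<Longrightarrow> vle X x y \<Longrightarrow>
      vle X (vscale X c x) (vscale X c y)"
    and ex_lub: "x \<in> vcar X \<Longrightarrow> y \<in> vcar X \<Longrightarrow> \<exists>z. is_lub X x y z"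
    and norm_mono: "x \<in> vcar X \<Longrightarrow> y \<in> vcar X \<Longrightarrow> is_abs X x u \<Longrightarrow> is_abs X y v \<Longrightarrow>
      vle X u v \<Longrightarrow> vnorm X x \<le> vnorm X y"


subsection \<open>Operators and duals\<close>

definition operators ::
  "('a, 'b) nspace_scheme \<Rightarrow> ('c, 'd) nspace_scheme \<Rightarrow> ('a \<Rightarrow> 'c) set" where
  "operators X E = {T. (\<forall>x\<in>vcar X. T x \<in> vcar E) \<and>
     (\<forall>x\<in>vcar X. \<forall>y\<in>vcar X. T (vadd X x y) = vadd E (T x) (T y)) \<and>
     (\<forall>c. \<forall>x\<in>vcar X. T (vscale X c x) = vscale E c (T x)) \<and>
     (\<exists>K. \<forall>x\<in>vcar X. vnorm E (T x) \<le> K * vnorm X x)}"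

definition opnorm ::
  "('a, 'b) nspace_scheme \<Rightarrow> ('c, 'd) nspace_scheme \<Rightarrow> ('a \<Rightarrow> 'c) \<Rightarrow> real" where
  "opnorm X E T = (SUP x\<in>{x \<in> vcar X. vnorm X x \<le> 1}. vnorm E (T x))"

definition positive_op ::
  "('a, 'b) nlattice_scheme \<Rightarrow> ('c, 'd) nlattice_scheme \<Rightarrow> ('a \<Rightarrow> 'c) \<Rightarrow> bool" where
  "positive_op X Z T \<longleftrightarrow> (\<forall>x\<in>vpos X. T x \<in> vpos Z)"

primrec vsum :: "('a, 'b) nspace_scheme \<Rightarrow> (nat \<Rightarrow> 'a) \<Rightarrow> nat \<Rightarrow> 'a" where
  "vsum E u 0 = vzero E"
| "vsum E u (Suc n) = vadd E (vsum E u n) (u n)"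

definition finite_rank ::
  "('a, 'b) nspace_scheme \<Rightarrow> ('c, 'd) nspace_scheme \<Rightarrow> ('a \<Rightarrow> 'c) \<Rightarrow> bool" where
  "finite_rank X E T \<longleftrightarrow> (\<exists>n b. (\<forall>i. b i \<in> vcar E) \<and>
     (\<forall>x\<in>vcar X. \<exists>c. T x = vsum E (\<lambda>i. vscale E (c i) (b i)) n))"

definition real_space :: "real nspace" where
  "real_space = \<lparr>vcar = UNIV, vadd = (+), vzero = 0, vscale = (*), vnorm = abs\<rparr>"

text \<open>Functionals are extensional, so that equality in the dual is equality of functions.\<close>

definition dual_space :: "('a, 'b) nspace_scheme \<Rightarrow> ('a \<Rightarrow> real) nspace" where
  "dual_space X = \<lparr>
     vcar = operators X real_space \<inter> extensional (vcar X),
     vadd = (\<lambda>f g. restrict (\<lambda>x. f x + g x) (vcar X)),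
     vzero = restrict (\<lambda>x. 0) (vcar X),
     vscale = (\<lambda>c f. restrict (\<lambda>x. c * f x) (vcar X)),
     vnorm = opnorm X real_space\<rparr>"

definition dual_pos :: "('a, 'b) nlattice_scheme \<Rightarrow> ('a \<Rightarrow> real) set" where
  "dual_pos X = {f \<in> vcar (dual_space X). \<forall>x\<in>vpos X. 0 \<le> f x}"

definition dual_ball :: "('a, 'b) nspace_scheme \<Rightarrow> ('a \<Rightarrow> real) set" where
  "dual_ball E = {f \<in> vcar (dual_space E). vnorm (dual_space E) f \<le> 1}"


subsection \<open>Strong and weak summability\<close>

text \<open>Exponents range over \<open>[1, \<infinity>]\<close>.  A sequence is summable iff its norm is finite.\<close>

definition conj_exp :: "ereal \<Rightarrow> ereal" where
  "conj_exp p = (if p = 1 then \<infinity> else if p = \<infinity> then 1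
     else ereal (real_of_ereal p / (real_of_ereal p - 1)))"

definition seq_norm :: "ereal \<Rightarrow> (nat \<Rightarrow> real) \<Rightarrow> ennreal" where
  "seq_norm q a =
    (if q = \<infinity> then SUP n. ennreal \<bar>a n\<bar>
     else if summable (\<lambda>n. \<bar>a n\<bar> powr real_of_ereal q)
     then ennreal ((\<Sum>n. \<bar>a n\<bar> powr real_of_ereal q) powr (1 / real_of_ereal q))
     else \<infinity>)"

definition strong_norm :: "ereal \<Rightarrow> ('a, 'b) nspace_scheme \<Rightarrow> (nat \<Rightarrow> 'a) \<Rightarrow> ennreal" where
  "strong_norm q E u = seq_norm q (\<lambda>n. vnorm E (u n))"

definition weak_norm :: "ereal \<Rightarrow> ('a, 'b) nspace_scheme \<Rightarrow> (nat \<Rightarrow> 'a) \<Rightarrow> ennreal" where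
  "weak_norm q E u = (SUP f\<in>dual_ball E. seq_norm q (\<lambda>n. f (u n)))"


subsection \<open>Positively $p$-nuclear and positively $p$-integral operators\<close>

text \<open>The series \<open>T = \<Sum>j. x\<^sub>j\<^sup>* \<otimes> u\<^sub>j\<close> converges in operator norm.\<close>

definition pos_nuclear_rep :: "ereal \<Rightarrow> ('a, 'b) nlattice_scheme \<Rightarrow> ('c, 'd) nspace_scheme \<Rightarrow>
    ('a \<Rightarrow> 'c) \<Rightarrow> (nat \<Rightarrow> 'a \<Rightarrow> real) \<Rightarrow> (nat \<Rightarrow> 'c) \<Rightarrow> bool" where
  "pos_nuclear_rep p X E T xs u \<longleftrightarrow>
     (\<forall>j. xs j \<in> dual_pos X) \<and> weak_norm (conj_exp p) (dual_space X) xs < \<infinity> \<and>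
     (\<forall>j. u j \<in> vcar E) \<and> strong_norm p E u < \<infinity> \<and>
     (\<lambda>n. opnorm X E (\<lambda>x. vminus E (T x) (vsum E (\<lambda>j. vscale E (xs j x) (u j)) n)))
       \<longlonglongrightarrow> 0"

definition pos_nuclear :: "ereal \<Rightarrow> ('a, 'b) nlattice_scheme \<Rightarrow> ('c, 'd) nspace_scheme \<Rightarrow>
    ('a \<Rightarrow> 'c) \<Rightarrow> bool" where
  "pos_nuclear p X E T \<longleftrightarrow> T \<in> operators X E \<and> (\<exists>xs u. pos_nuclear_rep p X E T xs u)"

definition pos_nuclear_norm :: "ereal \<Rightarrow> ('a, 'b) nlattice_scheme \<Rightarrow> ('c, 'd) nspace_scheme \<Rightarrow>
    ('a \<Rightarrow> 'c) \<Rightarrow> ennreal" where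
  "pos_nuclear_norm p X E T =
     Inf {weak_norm (conj_exp p) (dual_space X) xs * strong_norm p E u |
            xs u. pos_nuclear_rep p X E T xs u}"

text \<open>
  HOL cannot quantify over types inside a formula.  The types \<open>'y\<close> and \<open>'f\<close> in which the carriers
  of the test spaces \<open>Y\<close> and \<open>F\<close> live are therefore parameters; a theorem with \<open>'y\<close> and \<open>'f\<close> free
  speaks about all Banach lattices \<open>Y\<close> and all Banach spaces \<open>F\<close>.
\<close>

definition pos_integral_bound :: "'y itself \<Rightarrow> 'f itself \<Rightarrow> ereal \<Rightarrow>
    ('a, 'b) nlattice_scheme \<Rightarrow> ('c, 'd) nspace_scheme \<Rightarrow> ('a \<Rightarrow> 'c) \<Rightarrow> real \<Rightarrow> bool" where
  "pos_integral_bound _ _ p X E T C \<longleftrightarrow>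
     (\<forall>(Y :: 'y nlattice) (F :: 'f nspace) S R.
        banach_lattice Y \<longrightarrow> banach_space F \<longrightarrow>
        S \<in> operators Y X \<longrightarrow> positive_op Y X S \<longrightarrow> finite_rank Y X S \<longrightarrow>
        R \<in> operators E F \<longrightarrow> finite_rank E F R \<longrightarrow>
        pos_nuclear p Y F (R \<circ> T \<circ> S) \<and>
        pos_nuclear_norm p Y F (R \<circ> T \<circ> S) \<le> ennreal (C * opnorm E F R * opnorm Y X S))"

definition pos_integral :: "'y itself \<Rightarrow> 'f itself \<Rightarrow> ereal \<Rightarrow>
    ('a, 'b) nlattice_scheme \<Rightarrow> ('c, 'd) nspace_scheme \<Rightarrow> ('a \<Rightarrow> 'c) \<Rightarrow> bool" where
  "pos_integral ty tf p X E T \<longleftrightarrow>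
     T \<in> operators X E \<and> (\<exists>C>0. pos_integral_bound ty tf p X E T C)"

definition pos_integral_norm :: "'y itself \<Rightarrow> 'f itself \<Rightarrow> ereal \<Rightarrow>
    ('a, 'b) nlattice_scheme \<Rightarrow> ('c, 'd) nspace_scheme \<Rightarrow> ('a \<Rightarrow> 'c) \<Rightarrow> ennreal" where
  "pos_integral_norm ty tf p X E T =
     (INF C\<in>{C. 0 < C \<and> pos_integral_bound ty tf p X E T C}. ennreal C)"


subsection \<open>The Banach lattices $L_q(\mu)$\<close>

definition Lq_fun :: "'a measure \<Rightarrow> ereal \<Rightarrow> ('a \<Rightarrow> real) set" where
  "Lq_fun M q = {f \<in> borel_measurable M.
     if q = \<infinity> then esssup M (\<lambda>x. ereal \<bar>f x\<bar>) < \<infinity>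
     else integrable M (\<lambda>x. \<bar>f x\<bar> powr real_of_ereal q)}"

definition Lq_norm :: "'a measure \<Rightarrow> ereal \<Rightarrow> ('a \<Rightarrow> real) \<Rightarrow> real" where
  "Lq_norm M q f =
     (if q = \<infinity> then real_of_ereal (esssup M (\<lambda>x. ereal \<bar>f x\<bar>))
      else (\<integral>x. \<bar>f x\<bar> powr real_of_ereal q \<partial>M) powr (1 / real_of_ereal q))"

text \<open>
  Almost everywhere equality is taken on all measurable functions, independently of \<open>q\<close>: a class of
  \<open>L\<^sub>r(\<mu>)\<close> with \<open>r \<ge> q\<close> is then literally a class of \<open>L\<^sub>q(\<mu>)\<close> when \<open>\<mu>\<close> is a probability measure.
\<close>

definition ae_rel :: "'a measure \<Rightarrow> (('a \<Rightarrow> real) \<times> ('a \<Rightarrow> real)) set" where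
  "ae_rel M = {(f, g). f \<in> borel_measurable M \<and> g \<in> borel_measurable M \<and>
     (AE x in M. f x = g x)}"

definition ae_class :: "'a measure \<Rightarrow> ('a \<Rightarrow> real) \<Rightarrow> ('a \<Rightarrow> real) set" where
  "ae_class M f = ae_rel M `` {f}"

definition rep :: "('a \<Rightarrow> real) set \<Rightarrow> 'a \<Rightarrow> real" where
  "rep A = (SOME f. f \<in> A)"

definition Lq :: "'a measure \<Rightarrow> ereal \<Rightarrow> ('a \<Rightarrow> real) set nlattice" where
  "Lq M q = \<lparr>
     vcar = Lq_fun M q // ae_rel M,
     vadd = (\<lambda>A B. ae_class M (\<lambda>x. rep A x + rep B x)),
     vzero = ae_class M (\<lambda>x. 0),
     vscale = (\<lambda>c A. ae_class M (\<lambda>x. c * rep A x)),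
     vnorm = (\<lambda>A. Lq_norm M q (rep A)),
     vle = (\<lambda>A B. AE x in M. rep A x \<le> rep B x)\<rparr>"

definition Lq_incl :: "('a \<Rightarrow> real) set \<Rightarrow> ('a \<Rightarrow> real) set" where
  "Lq_incl A = A"

end

theory Submission
  imports Defs
begin

text \<open>
  A conditional expectation onto a finite partition \<open>(A\<^sub>j)\<close> gives an optimal representation:
  \<open>R E S = \<Sum>j. x\<^sub>j\<^sup>* \<otimes> u\<^sub>j\<close> with
  \<open>x\<^sub>j\<^sup>* = \<mu>(A\<^sub>j) powr (- 1 / p) \<cdot> \<integral>\<^bsub>A\<^sub>j\<^esub> S\<close> and
  \<open>u\<^sub>j = \<mu>(A\<^sub>j) powr (1 / p) \<cdot> R (1\<^bsub>A\<^sub>j\<^esub> / \<mu>(A\<^sub>j))\<close>.  Hoelder's inequality bounds the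
  weak norm of \<open>(x\<^sub>j\<^sup>*)\<close> by \<open>\<parallel>S\<parallel>\<close>, and \<open>\<Sum>j. \<mu>(A\<^sub>j) = 1\<close> bounds the strong norm of
  \<open>(u\<^sub>j)\<close> by \<open>\<parallel>R\<parallel>\<close>.  Since \<open>S\<close> has finite rank, for a fine partition the normalised indicators can be
  perturbed by \<open>\<epsilon>\<close> in \<open>L\<^sub>1\<close> so that the representation becomes one of \<open>R S\<close> itself; the positive
  functionals \<open>x\<^sub>j\<^sup>*\<close> remain unchanged.
\<close>

subsection \<open>Operators and duals\<close>

text \<open>An approximate factorisation does not suffice: the series must equal the operator, so
  the error of the conditional expectation has to be absorbed into the representation. Altering the
  functionals would endanger their positivity. The error is therefore moved into the kernels, where
  an L_1 bound is enough because R is defined on L_1; the approximation takes place in L_1 for every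
  p. The absorption works once the coefficients of a vector v can be computed from the cell
  integrals of v. Hence a finite-dimensional space containing the range of S gets generators s_i
  whose coefficient functionals are \<integral> h_i v with simple h_i. If every h_i is constant on
  the cells, each coefficient is a linear combination of cell integrals, and the error, a sum of
  coefficients times s_i - E s_i, can be distributed over the cells.\<close>

text \<open>
  The axioms of \<^locale>\<open>banach_space\<close> needed for operator norms; assuming no more spares a proof
  that duals and \<open>L\<^sub>q(\<mu>)\<close> are complete.
\<close>

locale pre_normed =
  fixes E :: "('a, 'b) nspace_scheme"
  assumes zero_closed: "vzero E \<in> vcar E"
    and add_closed: "x \<in> vcar E \<Longrightarrow> y \<in> vcar E \<Longrightarrow> vadd E x y \<in> vcar E"
    and scale_closed: "x \<in> vcar E \<Longrightarrow> vscale E c x \<in> vcar E"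
    and scale_zero: "x \<in> vcar E \<Longrightarrow> vscale E 0 x = vzero E"
    and norm_nonneg: "x \<in> vcar E \<Longrightarrow> 0 \<le> vnorm E x"
    and norm_scale: "x \<in> vcar E \<Longrightarrow> vnorm E (vscale E c x) = \<bar>c\<bar> * vnorm E x"
begin

lemma norm_zero: "vnorm E (vzero E) = 0"
  using norm_scale[OF zero_closed, of 0] scale_zero[OF zero_closed] by simp

lemma vsum_closed: "(\<And>i. i < n \<Longrightarrow> x i \<in> vcar E) \<Longrightarrow> vsum E x n \<in> vcar E"
  by (induction n) (auto simp: zero_closed add_closed)

end

context banach_space
begin

lemma vscale_0: assumes x: "x \<in> vcar E" shows "vscale E 0 x = vzero E"
proof -
  have "vnorm E (vscale E 0 x) = 0"
    using norm_scale[OF x, of 0] by simp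
  then show ?thesis using norm_eq_zero[OF scale_closed[OF x]] by blast
qed

lemma minus_self: "x \<in> vcar E \<Longrightarrow> vminus E x x = vzero E"
  by (simp add: vminus_def add_neg)

sublocale pre_normed E
  by unfold_locales
    (auto simp: zero_closed add_closed scale_closed vscale_0 norm_nonneg norm_scale)

end

interpretation real_space: pre_normed real_space
  by unfold_locales (auto simp: real_space_def abs_mult)

lemma vsum_cong: "(\<And>i. i < n \<Longrightarrow> x i = y i) \<Longrightarrow> vsum E x n = vsum E y n"
  by (induction n) auto

lemma vsum_real_space: "vsum real_space x n = (\<Sum>i<n. x i)"
  by (induction n) (auto simp: real_space_def)

lemma vsum_extend_zero:
  assumes "banach_space E" "\<And>i. i < N \<Longrightarrow> x i \<in> vcar E" "\<And>i. N \<le> i \<Longrightarrow> x i = vzero E" "N \<le> n"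
  shows "vsum E x n = vsum E x N"
  using \<open>N \<le> n\<close>
proof (induction n rule: dec_induct)
  case (step n)
  interpret banach_space E by fact
  have "vsum E x N \<in> vcar E" using assms by (intro vsum_closed) auto
  then show ?case using step assms by (simp add: add_zero)
qed simp

section \<open>Bounded operators and their norms\<close>

lemma operatorsD:
  assumes "T \<in> operators X E"
  shows "x \<in> vcar X \<Longrightarrow> T x \<in> vcar E"
    and "x \<in> vcar X \<Longrightarrow> y \<in> vcar X \<Longrightarrow> T (vadd X x y) = vadd E (T x) (T y)"
    and "x \<in> vcar X \<Longrightarrow> T (vscale X c x) = vscale E c (T x)"
  using assms by (auto simp: operators_def)

lemma operators_bounded:
  "T \<in> operators X E \<Longrightarrow> \<exists>K. \<forall>x\<in>vcar X. vnorm E (T x) \<le> K * vnorm X x"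
  by (simp add: operators_def)

lemma operator_zero:
  assumes "pre_normed X" "pre_normed E" "T \<in> operators X E"
  shows "T (vzero X) = vzero E"
  using operatorsD[OF assms(3)] assms(1,2) by (metis pre_normed.scale_zero pre_normed.zero_closed)

lemma operator_vsum:
  assumes X: "pre_normed X" and E: "pre_normed E" and T: "T \<in> operators X E"
    and x: "\<And>i. i < n \<Longrightarrow> x i \<in> vcar X"
  shows "T (vsum X x n) = vsum E (\<lambda>i. T (x i)) n"
  using x by (induction n) (auto simp: operator_zero[OF X E T] operatorsD[OF T] pre_normed.vsum_closed[OF X])

text \<open>A real \<open>SUP\<close> says nothing about an unbounded set, so every use of
  \<open>opnorm\<close> as an upper bound rests on this.\<close>

lemma opnorm_bdd:
  assumes "pre_normed X" "T \<in> operators X E"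
  shows "bdd_above ((\<lambda>x. vnorm E (T x)) ` {x \<in> vcar X. vnorm X x \<le> 1})"
proof -
  obtain K where K: "\<And>x. x \<in> vcar X \<Longrightarrow> vnorm E (T x) \<le> K * vnorm X x"
    using operators_bounded[OF assms(2)] by blast
  have "vnorm E (T x) \<le> \<bar>K\<bar>" if "x \<in> vcar X" "vnorm X x \<le> 1" for x
  proof -
    have "K * vnorm X x \<le> \<bar>K\<bar> * 1"
      using that pre_normed.norm_nonneg[OF assms(1) that(1)] by (intro mult_mono) auto
    then show ?thesis using K[OF that(1)] by simp
  qed
  then show ?thesis by (auto simp: bdd_above_def)
qed

lemma opnorm_nonneg:
  assumes "pre_normed X" "pre_normed E" "T \<in> operators X E"
  shows "0 \<le> opnorm X E T"
proof -
  interpret X: pre_normed X by fact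
  interpret E: pre_normed E by fact
  have "vnorm E (T (vzero X)) \<le> opnorm X E T"
    unfolding opnorm_def using X.zero_closed X.norm_zero
    by (intro cSUP_upper opnorm_bdd assms) auto
  then show ?thesis by (simp add: operator_zero[OF assms] E.norm_zero)
qed

lemma opnorm_bound:
  assumes "pre_normed X" "pre_normed E" "T \<in> operators X E" and x: "x \<in> vcar X"
  shows "vnorm E (T x) \<le> opnorm X E T * vnorm X x"
proof -
  interpret X: pre_normed X by fact
  interpret E: pre_normed E by fact
  obtain K where K: "\<And>x. x \<in> vcar X \<Longrightarrow> vnorm E (T x) \<le> K * vnorm X x"
    using operators_bounded[OF assms(3)] by blast
  show ?thesis
  proof (cases "vnorm X x = 0")
    case True
    then show ?thesis using K[OF x] by simp
  next
    case False
    then have pos: "vnorm X x > 0" using X.norm_nonneg[OF x] by simp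
    define c where "c = 1 / vnorm X x"
    have c: "c > 0" "c * vnorm X x = 1" using pos by (auto simp: c_def)
    have "vnorm E (T (vscale X c x)) \<le> opnorm X E T"
      unfolding opnorm_def using X.scale_closed[OF x] c
      by (intro cSUP_upper opnorm_bdd assms) (auto simp: X.norm_scale[OF x])
    then have "c * vnorm E (T x) \<le> opnorm X E T"
      using c by (simp add: operatorsD[OF assms(3)] x E.norm_scale)
    then show ?thesis using pos by (simp add: c_def field_simps)
  qed
qed

lemma opnorm_le:
  assumes "pre_normed X" "\<And>x. x \<in> vcar X \<Longrightarrow> vnorm X x \<le> 1 \<Longrightarrow> vnorm E (T x) \<le> C"
  shows "opnorm X E T \<le> C"
proof -
  interpret X: pre_normed X by fact
  show ?thesis
    unfolding opnorm_def using X.zero_closed X.norm_zero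
    by (intro cSUP_least) (auto intro: assms(2))
qed

lemma opnorm_cong: "(\<And>x. x \<in> vcar X \<Longrightarrow> vnorm E (T x) = vnorm E (T' x)) \<Longrightarrow> opnorm X E T = opnorm X E T'"
  unfolding opnorm_def by (intro SUP_cong) auto

lemma operators_comp:
  assumes "pre_normed X" "pre_normed E" "pre_normed F" "T \<in> operators X E" "R \<in> operators E F"
  shows "R \<circ> T \<in> operators X F"
proof -
  have "vnorm F (R (T x)) \<le> (opnorm E F R * opnorm X E T) * vnorm X x" if "x \<in> vcar X" for x
  proof -
    have "vnorm F (R (T x)) \<le> opnorm E F R * vnorm E (T x)"
      using assms that by (intro opnorm_bound) (auto simp: operatorsD)
    also have "\<dots> \<le> opnorm E F R * (opnorm X E T * vnorm X x)"
      using assms that by (intro mult_left_mono opnorm_bound opnorm_nonneg) auto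
    finally show ?thesis by (simp add: mult.assoc)
  qed
  then show ?thesis
    using operatorsD[OF assms(4)] operatorsD[OF assms(5)] unfolding operators_def by auto
qed

section \<open>The dual space and the bidual unit ball\<close>

lemma dual_opsI:
  assumes "f \<in> extensional (vcar X)"
    "\<And>x y. x \<in> vcar X \<Longrightarrow> y \<in> vcar X \<Longrightarrow> f (vadd X x y) = f x + f y"
    "\<And>c x. x \<in> vcar X \<Longrightarrow> f (vscale X c x) = c * f x"
    "\<And>x. x \<in> vcar X \<Longrightarrow> \<bar>f x\<bar> \<le> K * vnorm X x"
  shows "f \<in> vcar (dual_space X)"
proof -
  have "\<exists>K. \<forall>x\<in>vcar X. \<bar>f x\<bar> \<le> K * vnorm X x"
    using assms(4) by blast
  then show ?thesis
    using assms(1-3) unfolding dual_space_def operators_def by (auto simp: real_space_def)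
qed

lemma dual_opsD:
  assumes "f \<in> vcar (dual_space X)"
  shows "f \<in> operators X real_space"
    "x \<in> vcar X \<Longrightarrow> y \<in> vcar X \<Longrightarrow> f (vadd X x y) = f x + f y"
    "x \<in> vcar X \<Longrightarrow> f (vscale X c x) = c * f x"
    "\<exists>K. \<forall>x\<in>vcar X. \<bar>f x\<bar> \<le> K * vnorm X x"
  using assms unfolding dual_space_def operators_def by (auto simp: real_space_def)

text \<open>One inequality is enough for homogeneity of the dual norm: the reverse one is the same
  statement for \<open>1 / c\<close> with \<open>f\<close> and \<open>g\<close> exchanged.\<close>

lemma dual_opnorm_scale_le:
  assumes X: "pre_normed X" and f: "f \<in> operators X real_space"
    and g: "\<And>x. x \<in> vcar X \<Longrightarrow> g x = c * f x"
  shows "opnorm X real_space g \<le> \<bar>c\<bar> * opnorm X real_space f"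
proof (rule opnorm_le[OF X])
  fix x assume x: "x \<in> vcar X" "vnorm X x \<le> 1"
  have "\<bar>f x\<bar> \<le> opnorm X real_space f * vnorm X x"
    using opnorm_bound[OF X real_space.pre_normed_axioms f x(1)] by (simp add: real_space_def)
  also have "\<dots> \<le> opnorm X real_space f * 1"
    using x by (intro mult_left_mono opnorm_nonneg[OF X real_space.pre_normed_axioms f])
  finally show "vnorm real_space (g x) \<le> \<bar>c\<bar> * opnorm X real_space f"
    using x by (simp add: real_space_def g abs_mult mult_left_mono)
qed

text \<open>The weak norm of a sequence of functionals is a supremum over the bidual unit ball, so
  the bounds for operators on X must also be available on the dual of X.\<close>

lemma pre_normed_dual:
  assumes "pre_normed X"
  shows "pre_normed (dual_space X)"
proof -
  interpret X: pre_normed X by fact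
  note R = real_space.pre_normed_axioms
  have scale_closed: "vscale (dual_space X) c f \<in> vcar (dual_space X)"
    if f: "f \<in> vcar (dual_space X)" for f c
  proof -
    obtain K where K: "\<And>x. x \<in> vcar X \<Longrightarrow> \<bar>f x\<bar> \<le> K * vnorm X x" using dual_opsD(4)[OF f] by blast
    show ?thesis
      by (rule dual_opsI[where K="\<bar>c\<bar> * K"])
        (auto simp: dual_space_def X.add_closed X.scale_closed dual_opsD(2,3)[OF f]
           mult.left_commute mult.assoc distrib_left abs_mult intro: mult_left_mono[OF K, of _ "\<bar>c\<bar>", simplified mult.left_commute[of "\<bar>c\<bar>"]])
  qed
  have add_closed: "vadd (dual_space X) f g \<in> vcar (dual_space X)"
    if f: "f \<in> vcar (dual_space X)" and g: "g \<in> vcar (dual_space X)" for f g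
  proof -
    obtain K where K: "\<And>x. x \<in> vcar X \<Longrightarrow> \<bar>f x\<bar> \<le> K * vnorm X x" using dual_opsD(4)[OF f] by blast
    obtain L where L: "\<And>x. x \<in> vcar X \<Longrightarrow> \<bar>g x\<bar> \<le> L * vnorm X x" using dual_opsD(4)[OF g] by blast
    have KL: "\<bar>f x + g x\<bar> \<le> (K + L) * vnorm X x" if "x \<in> vcar X" for x
      using K[OF that] L[OF that] by (simp add: distrib_right)
    show ?thesis
      by (rule dual_opsI[where K="K + L"])
        (auto simp: dual_space_def X.add_closed X.scale_closed dual_opsD(2,3)[OF f] dual_opsD(2,3)[OF g]
           distrib_left KL)
  qed
  show ?thesis
  proof
    show "vzero (dual_space X) \<in> vcar (dual_space X)"
      by (rule dual_opsI[where K=0]) (auto simp: dual_space_def X.add_closed X.scale_closed)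
    fix f assume f: "f \<in> vcar (dual_space X)"
    note fo = dual_opsD(1)[OF f]
    show "vscale (dual_space X) 0 f = vzero (dual_space X)"
      by (simp add: dual_space_def)
    show "0 \<le> vnorm (dual_space X) f"
      using opnorm_nonneg[OF assms R fo] by (simp add: dual_space_def)
    show "vnorm (dual_space X) (vscale (dual_space X) c f) = \<bar>c\<bar> * vnorm (dual_space X) f" for c
    proof -
      define g where "g = vscale (dual_space X) c f"
      have g: "\<And>x. x \<in> vcar X \<Longrightarrow> g x = c * f x" by (simp add: g_def dual_space_def)
      have go: "g \<in> operators X real_space"
        using dual_opsD(1)[OF scale_closed[OF f]] by (simp add: g_def)
      have "opnorm X real_space g = \<bar>c\<bar> * opnorm X real_space f"
      proof (cases "c = 0")
        case True
        then show ?thesis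
          using dual_opnorm_scale_le[OF assms fo g] opnorm_nonneg[OF assms R go] by simp
      next
        case False
        then have "opnorm X real_space f \<le> \<bar>1 / c\<bar> * opnorm X real_space g"
          by (intro dual_opnorm_scale_le[OF assms go]) (simp add: g)
        then have "\<bar>c\<bar> * opnorm X real_space f \<le> opnorm X real_space g"
          using False by (simp add: field_simps)
        then show ?thesis using dual_opnorm_scale_le[OF assms fo g] by simp
      qed
      then show ?thesis by (simp add: g_def dual_space_def)
    qed
  qed (use scale_closed add_closed in auto)
qed

lemma vsum_dual:
  assumes X: "pre_normed X" and "x \<in> vcar X"
  shows "vsum (dual_space X) f n x = (\<Sum>i<n. f i x)"
  using assms(2) by (induction n) (auto simp: dual_space_def)

text \<open>A bidual element \<phi> in the unit ball sees a finite combination only through its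
  norm: |\<phi>(\<Sum> b_i f_i)| is at most the norm of \<Sum> b_i f_i, which is a supremum over the
  unit ball of X. Testing on points of X thus replaces testing on the bidual.\<close>

lemma dual_ball_combination:
  fixes f :: "nat \<Rightarrow> 'a \<Rightarrow> real"
  assumes X: "pre_normed X" and \<phi>: "\<phi> \<in> dual_ball (dual_space X)"
    and f: "\<And>i. i < n \<Longrightarrow> f i \<in> vcar (dual_space X)"
    and C: "\<And>x. x \<in> vcar X \<Longrightarrow> vnorm X x \<le> 1 \<Longrightarrow> \<bar>\<Sum>i<n. b i * f i x\<bar> \<le> C"
  shows "\<bar>\<Sum>i<n. b i * \<phi> (f i)\<bar> \<le> C"
proof -
  note R = real_space.pre_normed_axioms
  interpret X: pre_normed X by fact
  interpret D: pre_normed "dual_space X" by (rule pre_normed_dual[OF X])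
  interpret DD: pre_normed "dual_space (dual_space X)" by (rule pre_normed_dual[OF D.pre_normed_axioms])
  have \<phi>': "\<phi> \<in> vcar (dual_space (dual_space X))" "opnorm (dual_space X) real_space \<phi> \<le> 1"
    using \<phi> by (auto simp: dual_ball_def) (simp add: dual_space_def)
  note \<phi>o = dual_opsD(1)[OF \<phi>'(1)]
  define g where "g = vsum (dual_space X) (\<lambda>i. vscale (dual_space X) (b i) (f i)) n"
  have g: "g \<in> vcar (dual_space X)"
    unfolding g_def using f by (intro D.vsum_closed D.scale_closed)
  have gx: "g x = (\<Sum>i<n. b i * f i x)" if "x \<in> vcar X" for x
    unfolding g_def vsum_dual[OF X that] using that by (simp add: dual_space_def)
  have "\<phi> g = (\<Sum>i<n. b i * \<phi> (f i))"
    unfolding g_def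
    by (subst operator_vsum[OF D.pre_normed_axioms R \<phi>o])
      (auto simp: vsum_real_space dual_opsD(3)[OF \<phi>'(1)] f D.scale_closed)
  moreover have "\<bar>\<phi> g\<bar> \<le> opnorm (dual_space X) real_space \<phi> * vnorm (dual_space X) g"
    using opnorm_bound[OF D.pre_normed_axioms R \<phi>o g] by (simp add: real_space_def)
  moreover have "\<dots> \<le> 1 * vnorm (dual_space X) g"
    using \<phi>'(2) D.norm_nonneg[OF g] by (rule mult_right_mono)
  moreover have "vnorm (dual_space X) g \<le> C"
    unfolding dual_space_def using C gx by (auto intro!: opnorm_le[OF X] simp: real_space_def)
  ultimately show ?thesis by simp
qed

subsection \<open>The spaces $L_q(\mu)$\<close>

lemma ae_rel_equiv: "equiv (borel_measurable M) (ae_rel M)"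
proof (rule equivI)
  show "ae_rel M \<subseteq> borel_measurable M \<times> borel_measurable M" by (auto simp: ae_rel_def)
  show "refl_on (borel_measurable M) (ae_rel M)" by (auto simp: refl_on_def ae_rel_def)
  show "sym (ae_rel M)" by (auto simp: sym_def ae_rel_def elim: eventually_mono)
  show "trans (ae_rel M)" unfolding trans_def ae_rel_def by (auto elim: eventually_elim2)
qed

lemma ae_class_eqI:
  "f \<in> borel_measurable M \<Longrightarrow> g \<in> borel_measurable M \<Longrightarrow> (AE x in M. f x = g x) \<Longrightarrow>
    ae_class M f = ae_class M g"
  unfolding ae_class_def by (intro equiv_class_eq[OF ae_rel_equiv]) (simp add: ae_rel_def)

text \<open>\<open>rep\<close> is an arbitrary choice from the class and so known only up to a null
  set, which is why later identities between representatives are almost-everywhere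
  statements.\<close>

lemma rep_ae_class:
  assumes f: "f \<in> borel_measurable M"
  shows "rep (ae_class M f) \<in> borel_measurable M" "AE x in M. rep (ae_class M f) x = f x"
proof -
  have "f \<in> ae_class M f" using f by (simp add: ae_class_def ae_rel_def)
  then have "rep (ae_class M f) \<in> ae_class M f" unfolding rep_def by (rule someI[of "\<lambda>g. g \<in> ae_class M f"])
  then show "rep (ae_class M f) \<in> borel_measurable M" "AE x in M. rep (ae_class M f) x = f x"
    by (auto simp: ae_class_def ae_rel_def elim: eventually_mono)
qed

lemma Lq_fun_measurable: "f \<in> Lq_fun M q \<Longrightarrow> f \<in> borel_measurable M"
  by (simp add: Lq_fun_def)

lemma Lq_fun_cong:
  assumes "f \<in> Lq_fun M q" and g[measurable]: "g \<in> borel_measurable M" and ae: "AE x in M. f x = g x"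
  shows "g \<in> Lq_fun M q"
proof -
  have f[measurable]: "f \<in> borel_measurable M" using assms(1) by (rule Lq_fun_measurable)
  have "esssup M (\<lambda>x. ereal \<bar>f x\<bar>) = esssup M (\<lambda>x. ereal \<bar>g x\<bar>)"
    using ae by (intro esssup_AE_cong) (auto elim: eventually_mono)
  moreover have "integrable M (\<lambda>x. \<bar>f x\<bar> powr Q) \<longleftrightarrow> integrable M (\<lambda>x. \<bar>g x\<bar> powr Q)" for Q
    using ae by (intro integrable_cong_AE) (auto elim: eventually_mono)
  ultimately show ?thesis using assms by (auto simp: Lq_fun_def split: if_splits)
qed

lemma Lq_norm_cong:
  assumes [measurable]: "f \<in> borel_measurable M" "g \<in> borel_measurable M" and ae: "AE x in M. f x = g x"
  shows "Lq_norm M q f = Lq_norm M q g"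
proof -
  have "esssup M (\<lambda>x. ereal \<bar>f x\<bar>) = esssup M (\<lambda>x. ereal \<bar>g x\<bar>)"
    using ae by (intro esssup_AE_cong) (auto elim: eventually_mono)
  moreover have "(\<integral>x. \<bar>f x\<bar> powr Q \<partial>M) = (\<integral>x. \<bar>g x\<bar> powr Q \<partial>M)" for Q
    using ae by (intro integral_cong_AE) (auto elim: eventually_mono)
  ultimately show ?thesis by (simp add: Lq_norm_def)
qed

text \<open>The function picked by \<open>rep\<close> may differ from the one that generated the
  class; it still belongs to the space because integrability and the essential supremum ignore null
  sets.\<close>

lemma Lq_carrier:
  assumes "A \<in> vcar (Lq M q)"
  shows "rep A \<in> Lq_fun M q" "ae_class M (rep A) = A"
proof -
  obtain f where f: "f \<in> Lq_fun M q" "A = ae_class M f"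
    using assms by (auto simp: Lq_def ae_class_def elim!: quotientE)
  have fm: "f \<in> borel_measurable M" using f(1) by (rule Lq_fun_measurable)
  have r: "rep A \<in> borel_measurable M" "AE x in M. rep A x = f x"
    using rep_ae_class[OF fm] f(2) by auto
  then have ae: "AE x in M. f x = rep A x" by (auto elim: eventually_mono)
  show "rep A \<in> Lq_fun M q" using Lq_fun_cong[OF f(1) r(1) ae] .
  show "ae_class M (rep A) = A" using ae_class_eqI[OF r(1) fm r(2)] f(2) by simp
qed

lemma Lq_carrierE:
  assumes "A \<in> vcar (Lq M q)"
  obtains f where "f \<in> Lq_fun M q" "A = ae_class M f"
  by (rule that[OF Lq_carrier(1)[OF assms] Lq_carrier(2)[OF assms, symmetric]])

lemma ae_class_in_Lq: "f \<in> Lq_fun M q \<Longrightarrow> ae_class M f \<in> vcar (Lq M q)"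
  by (auto simp: Lq_def ae_class_def intro: quotientI)

lemma vnorm_ae_class: "f \<in> borel_measurable M \<Longrightarrow> vnorm (Lq M q) (ae_class M f) = Lq_norm M q f"
  by (auto simp: Lq_def intro!: Lq_norm_cong rep_ae_class)

lemma vnorm_Lq: "vnorm (Lq M q) A = Lq_norm M q (rep A)"
  by (simp add: Lq_def)

lemma vadd_ae_class:
  assumes [measurable]: "f \<in> borel_measurable M" "g \<in> borel_measurable M"
  shows "vadd (Lq M q) (ae_class M f) (ae_class M g) = ae_class M (\<lambda>x. f x + g x)"
proof -
  note [measurable] = rep_ae_class(1)[of f M] rep_ae_class(1)[of g M]
  have "AE x in M. rep (ae_class M f) x + rep (ae_class M g) x = f x + g x"
    using rep_ae_class(2)[of f M] rep_ae_class(2)[of g M] by (auto elim: eventually_elim2)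
  then show ?thesis by (simp add: Lq_def ae_class_eqI)
qed

lemma vscale_ae_class:
  assumes [measurable]: "f \<in> borel_measurable M"
  shows "vscale (Lq M q) c (ae_class M f) = ae_class M (\<lambda>x. c * f x)"
proof -
  note [measurable] = rep_ae_class(1)[of f M]
  have "AE x in M. c * rep (ae_class M f) x = c * f x"
    using rep_ae_class(2)[of f M] by (auto elim: eventually_mono)
  then show ?thesis by (simp add: Lq_def ae_class_eqI)
qed

lemma vzero_Lq: "vzero (Lq M q) = ae_class M (\<lambda>x. 0)"
  by (simp add: Lq_def)

lemma vsum_ae_class:
  assumes "\<And>i. i < n \<Longrightarrow> f i \<in> borel_measurable M"
  shows "vsum (Lq M q) (\<lambda>i. ae_class M (f i)) n = ae_class M (\<lambda>x. \<Sum>i<n. f i x)"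
  using assms
proof (induction n)
  case (Suc n)
  then have [measurable]: "(\<lambda>x. \<Sum>i<n. f i x) \<in> borel_measurable M" by (intro borel_measurable_sum) auto
  show ?case using Suc by (simp add: vadd_ae_class)
qed (simp add: vzero_Lq)

text \<open>Two forms of conjugacy are kept side by side: 1/P + 1/Q = 1 serves Young's inequality,
  and \<open>(Q - 1) * P = Q\<close> makes |a|^(Q-1) an extremal sequence in the duality of l_P and
  l_Q.\<close>

lemma conj_exp_cases:
  assumes "1 \<le> p" "p < \<infinity>"
  obtains (one) "p = 1" "conj_exp p = \<infinity>"
  | (gt) P Q where "p = ereal P" "conj_exp p = ereal Q" "1 < P" "1 < Q" "1 / P + 1 / Q = 1" "(Q - 1) * P = Q"
proof (cases "p = 1")
  case True
  then show ?thesis using one by (simp add: conj_exp_def)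
next
  case False
  then obtain P where P: "p = ereal P" "1 < P"
    using assms by (cases p) (auto simp: one_ereal_def)
  then have "conj_exp p = ereal (P / (P - 1))" by (auto simp: conj_exp_def one_ereal_def)
  then show ?thesis using P by (intro gt[of P "P / (P - 1)"]) (auto simp: field_simps)
qed

lemma conj_exp_ge_1: "1 \<le> p \<Longrightarrow> p < \<infinity> \<Longrightarrow> 1 \<le> conj_exp p"
  by (erule (1) conj_exp_cases) auto

section \<open>The spaces L_q of a probability measure, for exponents from 1 to \<infinity>\<close>

context prob_space
begin

text \<open>Total mass one matters: over the zero measure the essential supremum would be
  -\<infinity>. Nonnegativity is what makes a supremum below \<infinity> a real number.\<close>

lemma esssup_abs_nonneg:
  assumes "f \<in> borel_measurable M"
  shows "0 \<le> esssup M (\<lambda>x. ereal \<bar>f x\<bar>)"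
proof -
  have "esssup M (\<lambda>x. 0 :: ereal) \<le> esssup M (\<lambda>x. ereal \<bar>f x\<bar>)"
    by (intro esssup_mono) auto
  then show ?thesis using esssup_const[of M "0 :: ereal"] by (simp add: emeasure_space_1)
qed

lemma Lq_fun_infinity:
  "f \<in> Lq_fun M \<infinity> \<longleftrightarrow> f \<in> borel_measurable M \<and> (\<exists>c. AE x in M. \<bar>f x\<bar> \<le> c)"
proof -
  have "esssup M (\<lambda>x. ereal \<bar>f x\<bar>) < \<infinity> \<longleftrightarrow> (\<exists>c. AE x in M. \<bar>f x\<bar> \<le> c)"
    if f[measurable]: "f \<in> borel_measurable M"
  proof
    assume lt: "esssup M (\<lambda>x. ereal \<bar>f x\<bar>) < \<infinity>"
    obtain c where c: "esssup M (\<lambda>x. ereal \<bar>f x\<bar>) = ereal c"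
      using lt esssup_abs_nonneg[OF f] by (cases "esssup M (\<lambda>x. ereal \<bar>f x\<bar>)") auto
    show "\<exists>c. AE x in M. \<bar>f x\<bar> \<le> c" using esssup_AE[of "\<lambda>x. ereal \<bar>f x\<bar>" M] unfolding c by auto
  next
    assume "\<exists>c. AE x in M. \<bar>f x\<bar> \<le> c"
    then obtain c where "AE x in M. ereal \<bar>f x\<bar> \<le> ereal c" by auto
    then have "esssup M (\<lambda>x. ereal \<bar>f x\<bar>) \<le> ereal c" by (intro esssup_I) auto
    then show "esssup M (\<lambda>x. ereal \<bar>f x\<bar>) < \<infinity>" by (auto simp: less_ereal.simps intro: le_less_trans)
  qed
  then show ?thesis by (auto simp: Lq_fun_def)
qed

lemma AE_le_Lq_norm_infinity:
  assumes "f \<in> Lq_fun M \<infinity>"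
  shows "AE x in M. \<bar>f x\<bar> \<le> Lq_norm M \<infinity> f"
proof -
  have f: "f \<in> borel_measurable M" "esssup M (\<lambda>x. ereal \<bar>f x\<bar>) < \<infinity>"
    using assms by (auto simp: Lq_fun_def)
  obtain c where c: "esssup M (\<lambda>x. ereal \<bar>f x\<bar>) = ereal c"
    using f(2) esssup_abs_nonneg[OF f(1)] by (cases "esssup M (\<lambda>x. ereal \<bar>f x\<bar>)") auto
  show ?thesis using esssup_AE[of "\<lambda>x. ereal \<bar>f x\<bar>" M] unfolding Lq_norm_def c by simp
qed

lemma Lq_norm_nonneg: "f \<in> borel_measurable M \<Longrightarrow> 0 \<le> Lq_norm M q f"
  using esssup_abs_nonneg[of f] by (auto simp: Lq_norm_def intro!: real_of_ereal_pos)

lemma Lq_fun_scale: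
  assumes "f \<in> Lq_fun M q" "1 \<le> q"
  shows "(\<lambda>x. c * f x) \<in> Lq_fun M q"
proof (cases "q = \<infinity>")
  case True
  then obtain d where "f \<in> borel_measurable M" and d: "AE x in M. \<bar>f x\<bar> \<le> d"
    using assms Lq_fun_infinity by auto
  moreover have "AE x in M. \<bar>c * f x\<bar> \<le> \<bar>c\<bar> * d"
    using d by eventually_elim (simp add: abs_mult mult_left_mono)
  ultimately show ?thesis unfolding True Lq_fun_infinity by auto
next
  case False
  then show ?thesis using assms by (auto simp: Lq_fun_def abs_mult powr_mult)
qed

lemma Lq_norm_scale:
  assumes f: "f \<in> Lq_fun M q" and q: "1 \<le> q"
  shows "Lq_norm M q (\<lambda>x. c * f x) = \<bar>c\<bar> * Lq_norm M q f"
proof (cases "q = \<infinity>")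
  case True
  have [measurable]: "f \<in> borel_measurable M" using f by (rule Lq_fun_measurable)
  show ?thesis
  proof (cases "c = 0")
    case True
    then show ?thesis using \<open>q = \<infinity>\<close> esssup_const[of M "0 :: ereal"]
      by (simp add: Lq_norm_def emeasure_space_1 zero_ereal_def[symmetric])
  next
    case False
    then have "esssup M (\<lambda>x. ereal \<bar>c * f x\<bar>) = ereal \<bar>c\<bar> * esssup M (\<lambda>x. ereal \<bar>f x\<bar>)"
      using esssup_cmult[of "\<bar>c\<bar>" M "\<lambda>x. ereal \<bar>f x\<bar>"] by (simp add: abs_mult)
    then show ?thesis using \<open>q = \<infinity>\<close> by (simp add: Lq_norm_def)
  qed
next
  case False
  then obtain Q where Q: "q = ereal Q" "Q \<ge> 1" using q by (cases q) auto
  then show ?thesis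
    by (simp add: Lq_norm_def abs_mult powr_mult powr_powr integral_nonneg)
qed

lemma Lq_fun_add:
  assumes f: "f \<in> Lq_fun M q" and g: "g \<in> Lq_fun M q" and q: "1 \<le> q"
  shows "(\<lambda>x. f x + g x) \<in> Lq_fun M q"
proof (cases "q = \<infinity>")
  case True
  then obtain c d where "f \<in> borel_measurable M" "g \<in> borel_measurable M"
    and c: "AE x in M. \<bar>f x\<bar> \<le> c" and d: "AE x in M. \<bar>g x\<bar> \<le> d"
    using f g Lq_fun_infinity by auto
  moreover have "AE x in M. \<bar>f x + g x\<bar> \<le> c + d"
    using c d by eventually_elim simp
  ultimately show ?thesis unfolding True Lq_fun_infinity by auto
next
  case False
  then obtain Q where Q: "q = ereal Q" "Q \<ge> 1" using q by (cases q) auto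
  then have [measurable]: "f \<in> borel_measurable M" "g \<in> borel_measurable M"
    and i: "integrable M (\<lambda>x. \<bar>f x\<bar> powr Q)" "integrable M (\<lambda>x. \<bar>g x\<bar> powr Q)"
    using f g by (auto simp: Lq_fun_def)
  \<comment> \<open>Only membership is at stake, so the crude bound |a + b| \<le> 2 max(|a|, |b|)
    suffices.\<close>
  have bound: "\<bar>a + b\<bar> powr Q \<le> 2 powr Q * (\<bar>a\<bar> powr Q + \<bar>b\<bar> powr Q)" for a b :: real
  proof -
    have "\<bar>a + b\<bar> powr Q \<le> (2 * max \<bar>a\<bar> \<bar>b\<bar>) powr Q" using Q by (intro powr_mono2) auto
    also have "\<dots> = 2 powr Q * (max \<bar>a\<bar> \<bar>b\<bar> powr Q)" by (simp add: powr_mult)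
    also have "\<dots> \<le> 2 powr Q * (\<bar>a\<bar> powr Q + \<bar>b\<bar> powr Q)"
      by (intro mult_left_mono) (auto simp: max_def)
    finally show ?thesis .
  qed
  have "integrable M (\<lambda>x. \<bar>f x + g x\<bar> powr Q)"
  proof (rule Bochner_Integration.integrable_bound)
    show "integrable M (\<lambda>x. 2 powr Q * (\<bar>f x\<bar> powr Q + \<bar>g x\<bar> powr Q))" using i by simp
    show "AE x in M. norm (\<bar>f x + g x\<bar> powr Q) \<le> norm (2 powr Q * (\<bar>f x\<bar> powr Q + \<bar>g x\<bar> powr Q))"
      using bound by (intro AE_I2) (smt (verit) real_norm_def powr_ge_zero)
  qed simp
  then show ?thesis using Q by (simp add: Lq_fun_def)
qed

lemma pre_normed_Lq:
  assumes q: "1 \<le> q"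
  shows "pre_normed (Lq M q)"
proof
  have z: "(\<lambda>x. 0) \<in> Lq_fun M q"
  proof (cases "q = \<infinity>")
    case True
    then show ?thesis by (auto simp only: Lq_fun_infinity abs_zero intro!: exI[of _ 0]) auto
  qed (simp add: Lq_fun_def)
  have [simp]: "f \<in> borel_measurable M" if "f \<in> Lq_fun M q" for f using that by (rule Lq_fun_measurable)
  show "vzero (Lq M q) \<in> vcar (Lq M q)"
    unfolding vzero_Lq by (rule ae_class_in_Lq[OF z])
  fix A assume "A \<in> vcar (Lq M q)"
  then obtain f where f: "f \<in> Lq_fun M q" "A = ae_class M f" by (rule Lq_carrierE)
  show "vscale (Lq M q) c A \<in> vcar (Lq M q)" for c
    using f by (simp add: vscale_ae_class ae_class_in_Lq Lq_fun_scale q)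
  show "vscale (Lq M q) 0 A = vzero (Lq M q)" using f by (simp add: vscale_ae_class vzero_Lq)
  show "0 \<le> vnorm (Lq M q) A" using f by (simp add: vnorm_ae_class Lq_norm_nonneg)
  show "vnorm (Lq M q) (vscale (Lq M q) c A) = \<bar>c\<bar> * vnorm (Lq M q) A" for c
    using f by (simp add: vscale_ae_class vnorm_ae_class Lq_fun_measurable[OF Lq_fun_scale] Lq_norm_scale q)
  fix B assume "B \<in> vcar (Lq M q)"
  then obtain g where g: "g \<in> Lq_fun M q" "B = ae_class M g" by (rule Lq_carrierE)
  show "vadd (Lq M q) A B \<in> vcar (Lq M q)"
    using f g by (simp add: vadd_ae_class ae_class_in_Lq Lq_fun_add q)
qed

section \<open>Hoelder's inequality and the inclusion into L_1\<close>

lemma Lq_fun_1: "f \<in> Lq_fun M 1 \<longleftrightarrow> integrable M f"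
  by (auto simp: Lq_fun_def one_ereal_def integrable_abs_iff)

lemma Lq_norm_1: "f \<in> borel_measurable M \<Longrightarrow> Lq_norm M 1 f = (\<integral>x. \<bar>f x\<bar> \<partial>M)"
  by (auto simp: Lq_norm_def one_ereal_def)

text \<open>Young's inequality gives integrability pointwise; applied to \<open>f x / s\<close> and
  \<open>g x / t\<close>, where both functions are scaled to norm one, its right-hand side
  integrates to 1/P + 1/Q = 1.\<close>

lemma Hoelder_powr:
  fixes P Q :: real
  assumes PQ: "1 < P" "1 < Q" "1 / P + 1 / Q = 1"
    and [measurable]: "f \<in> borel_measurable M" "g \<in> borel_measurable M"
    and f: "integrable M (\<lambda>x. \<bar>f x\<bar> powr P)" and g: "integrable M (\<lambda>x. \<bar>g x\<bar> powr Q)"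
  shows "integrable M (\<lambda>x. f x * g x)"
    and "(\<integral>x. \<bar>f x * g x\<bar> \<partial>M) \<le> (\<integral>x. \<bar>f x\<bar> powr P \<partial>M) powr (1 / P) * (\<integral>x. \<bar>g x\<bar> powr Q \<partial>M) powr (1 / Q)"
proof -
  have young: "\<bar>a * b\<bar> \<le> \<bar>a\<bar> powr P / P + \<bar>b\<bar> powr Q / Q" for a b :: real
    using Youngs_inequality[of P Q "\<bar>a\<bar>" "\<bar>b\<bar>"] PQ by (simp add: abs_mult)
  show int: "integrable M (\<lambda>x. f x * g x)"
    by (rule Bochner_Integration.integrable_bound[where f="\<lambda>x. \<bar>f x\<bar> powr P / P + \<bar>g x\<bar> powr Q / Q"])
      (use f g young PQ in \<open>auto simp: order_trans[OF young]\<close>)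
  define a where "a = (\<integral>x. \<bar>f x\<bar> powr P \<partial>M)"
  define b where "b = (\<integral>x. \<bar>g x\<bar> powr Q \<partial>M)"
  have ab: "a \<ge> 0" "b \<ge> 0" by (auto simp: a_def b_def)
  show "(\<integral>x. \<bar>f x * g x\<bar> \<partial>M) \<le> a powr (1 / P) * b powr (1 / Q)"
  proof (cases "a = 0 \<or> b = 0")
    \<comment> \<open>A factor of norm zero cannot be normalised, but then the product vanishes
      almost everywhere.\<close>
    case True
    then have "AE x in M. f x * g x = 0"
    proof
      assume "a = 0"
      then have "AE x in M. \<bar>f x\<bar> powr P = 0" using f unfolding a_def by (subst (asm) integral_nonneg_eq_0_iff_AE) auto
      then show ?thesis by (auto elim: eventually_mono)
    next
      assume "b = 0"
      then have "AE x in M. \<bar>g x\<bar> powr Q = 0" using g unfolding b_def by (subst (asm) integral_nonneg_eq_0_iff_AE) auto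
      then show ?thesis by (auto elim: eventually_mono)
    qed
    then have "(\<integral>x. \<bar>f x * g x\<bar> \<partial>M) = 0" by (intro integral_eq_zero_AE) (auto elim: eventually_mono)
    then show ?thesis by simp
  next
    case False
    then have pos: "a > 0" "b > 0" using ab by auto
    define s where "s = a powr (1 / P)"
    define t where "t = b powr (1 / Q)"
    have st: "s > 0" "t > 0" using pos by (auto simp: s_def t_def)
    have sP: "s powr P = a" "t powr Q = b" using pos PQ by (auto simp: s_def t_def powr_powr)
    have "(\<integral>x. \<bar>f x * g x\<bar> / (s * t) \<partial>M) \<le> (\<integral>x. \<bar>f x\<bar> powr P / a / P + \<bar>g x\<bar> powr Q / b / Q \<partial>M)"
    proof (rule integral_mono)
      fix x
      have "\<bar>f x * g x\<bar> / (s * t) = \<bar>(f x / s) * (g x / t)\<bar>" using st by (simp add: abs_mult)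
      also have "\<dots> \<le> \<bar>f x / s\<bar> powr P / P + \<bar>g x / t\<bar> powr Q / Q" by (rule young)
      also have "\<dots> = \<bar>f x\<bar> powr P / a / P + \<bar>g x\<bar> powr Q / b / Q"
        using st by (simp add: powr_divide sP)
      finally show "\<bar>f x * g x\<bar> / (s * t) \<le> \<bar>f x\<bar> powr P / a / P + \<bar>g x\<bar> powr Q / b / Q" .
    qed (use int f g in auto)
    also have "\<dots> = 1 / P + 1 / Q"
      using f g pos by (simp add: a_def[symmetric] b_def[symmetric])
    finally have "(\<integral>x. \<bar>f x * g x\<bar> \<partial>M) / (s * t) \<le> 1" using PQ by simp
    then show ?thesis using st by (simp add: s_def t_def field_simps)
  qed
qed

lemma Hoelder:
  assumes p: "1 \<le> p" "p < \<infinity>" and f: "f \<in> Lq_fun M p" and g: "g \<in> Lq_fun M (conj_exp p)"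
  shows "integrable M (\<lambda>x. f x * g x)"
    and "(\<integral>x. \<bar>f x * g x\<bar> \<partial>M) \<le> Lq_norm M p f * Lq_norm M (conj_exp p) g"
proof -
  have [measurable]: "f \<in> borel_measurable M" "g \<in> borel_measurable M"
    using f g by (auto intro: Lq_fun_measurable)
  have "integrable M (\<lambda>x. f x * g x) \<and>
    (\<integral>x. \<bar>f x * g x\<bar> \<partial>M) \<le> Lq_norm M p f * Lq_norm M (conj_exp p) g"
    using p
  proof (cases rule: conj_exp_cases)
    case one
    let ?c = "Lq_norm M \<infinity> g"
    have fi: "integrable M f" using f by (simp add: one Lq_fun_1)
    have "AE x in M. \<bar>g x\<bar> \<le> ?c"
      using AE_le_Lq_norm_infinity[of g] g unfolding one(2) by simp
    then have ae: "AE x in M. \<bar>f x * g x\<bar> \<le> \<bar>f x\<bar> * ?c"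
      by eventually_elim (simp add: abs_mult mult_left_mono)
    have int: "integrable M (\<lambda>x. f x * g x)"
      by (rule Bochner_Integration.integrable_bound[where f="\<lambda>x. \<bar>f x\<bar> * ?c"])
        (use fi ae in \<open>auto elim: eventually_mono\<close>)
    have "(\<integral>x. \<bar>f x * g x\<bar> \<partial>M) \<le> (\<integral>x. \<bar>f x\<bar> * ?c \<partial>M)"
      using int fi ae by (intro integral_mono_AE) auto
    then show ?thesis using int by (simp add: one(2)) (simp add: one(1) Lq_norm_1)
  next
    case (gt P Q)
    then show ?thesis using f g Hoelder_powr[of P Q f g] by (simp add: Lq_norm_def Lq_fun_def)
  qed
  then show "integrable M (\<lambda>x. f x * g x)"
    and "(\<integral>x. \<bar>f x * g x\<bar> \<partial>M) \<le> Lq_norm M p f * Lq_norm M (conj_exp p) g" by auto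
qed

text \<open>Hoelder's inequality against the constant 1, whose L_p norm is 1 for a probability
  measure; this is why the inclusion costs no constant.\<close>

lemma Lq_conj_subset_L1:
  assumes p: "1 \<le> p" "p < \<infinity>" and g: "g \<in> Lq_fun M (conj_exp p)"
  shows "integrable M g" "(\<integral>x. \<bar>g x\<bar> \<partial>M) \<le> Lq_norm M (conj_exp p) g"
proof -
  have 1: "(\<lambda>x. 1) \<in> Lq_fun M p" "Lq_norm M p (\<lambda>x. 1) = 1"
    using p by (auto simp: Lq_fun_def Lq_norm_def prob_space)
  show "integrable M g" "(\<integral>x. \<bar>g x\<bar> \<partial>M) \<le> Lq_norm M (conj_exp p) g"
    using Hoelder[OF p 1(1) g] by (auto simp: 1)
qed

text \<open>In \<open>Lq\<close> only the carrier and the norm depend on the exponent; addition and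
  scaling of classes do not. Linearity of the identity is therefore immediate, and membership with
  the norm bound is the whole content.\<close>

lemma Lq_incl_operator:
  assumes p: "1 \<le> p" "p < \<infinity>"
  shows "Lq_incl \<in> operators (Lq M (conj_exp p)) (Lq M 1)"
proof -
  have "A \<in> vcar (Lq M 1) \<and> vnorm (Lq M 1) A \<le> 1 * vnorm (Lq M (conj_exp p)) A"
    if "A \<in> vcar (Lq M (conj_exp p))" for A
    using Lq_conj_subset_L1[OF p Lq_carrier(1)[OF that]] Lq_carrier(2)[OF that]
      ae_class_in_Lq[of "rep A" M 1] by (auto simp: vnorm_Lq Lq_fun_1 Lq_norm_1)
  then have "\<exists>K. \<forall>A\<in>vcar (Lq M (conj_exp p)). vnorm (Lq M 1) A \<le> K * vnorm (Lq M (conj_exp p)) A"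
    and "\<And>A. A \<in> vcar (Lq M (conj_exp p)) \<Longrightarrow> A \<in> vcar (Lq M 1)" by blast+
  then show ?thesis unfolding operators_def Lq_incl_def
    by (auto simp: Lq_def)
qed

end

subsection \<open>Partitions adapted to a finite-dimensional subspace\<close>

lemma simple_function_bounded:
  fixes h :: "'a \<Rightarrow> real"
  assumes "simple_function M h"
  obtains B where "0 \<le> B" "\<And>x. x \<in> space M \<Longrightarrow> \<bar>h x\<bar> \<le> B"
proof -
  have "finite (h ` space M)" using assms by (rule simple_functionD)
  then obtain B where "\<And>y. y \<in> h ` space M \<Longrightarrow> norm y \<le> B"
    using finite_imp_bounded bounded_iff by metis
  then show ?thesis by (intro that[of "max B 0"]) (auto intro: max.coboundedI1)
qed

lemma integrable_simple_mult:
  fixes h v :: "'a \<Rightarrow> real"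
  assumes h: "simple_function M h" and v: "integrable M v"
  shows "integrable M (\<lambda>x. h x * v x)"
proof -
  obtain B where B: "0 \<le> B" "\<And>x. x \<in> space M \<Longrightarrow> \<bar>h x\<bar> \<le> B" using simple_function_bounded[OF h] by blast
  have [measurable]: "h \<in> borel_measurable M" using h by (rule borel_measurable_simple_function)
  show ?thesis
  proof (rule Bochner_Integration.integrable_bound)
    show "integrable M (\<lambda>x. B * \<bar>v x\<bar>)" using v by simp
    show "AE x in M. norm (h x * v x) \<le> norm (B * \<bar>v x\<bar>)"
      using B by (intro AE_I2) (auto simp: abs_mult intro!: mult_right_mono)
  qed (use v in measurable)
qed

text \<open>The Bochner integral is built on L_1 approximation by simple functions; the approximants
  are read off from the definition of \<open>has_bochner_integral\<close>.\<close>

lemma simple_function_approximation: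
  fixes s :: "'a \<Rightarrow> real"
  assumes s: "integrable M s" and e: "0 < e"
  obtains t where "simple_function M t" "integrable M t" "(\<integral>x. \<bar>s x - t x\<bar> \<partial>M) < e"
proof -
  obtain z where "has_bochner_integral M s z" using s by (auto simp: integrable.simps)
  then have "\<exists>t. (\<forall>i. Bochner_Integration.simple_bochner_integrable M (t i)) \<and>
    (\<lambda>i. \<integral>\<^sup>+x. norm (s x - t i x) \<partial>M) \<longlonglongrightarrow> 0"
    by cases auto
  then obtain t where t: "\<And>i. Bochner_Integration.simple_bochner_integrable M (t i)"
    and lim: "(\<lambda>i. \<integral>\<^sup>+x. norm (s x - t i x) \<partial>M) \<longlonglongrightarrow> 0"
    by blast
  have "eventually (\<lambda>i. (\<integral>\<^sup>+x. norm (s x - t i x) \<partial>M) < ennreal e) sequentially"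
    using lim e by (intro order_tendstoD(2)) auto
  then obtain i where i: "(\<integral>\<^sup>+x. norm (s x - t i x) \<partial>M) < ennreal e"
    by (auto simp: eventually_sequentially)
  have sf: "simple_function M (t i)" using t[of i] by (auto elim: Bochner_Integration.simple_bochner_integrable.cases)
  have ti: "integrable M (t i)" using t[of i] by (auto simp: integrable.simps intro: has_bochner_integral_simple_bochner_integrable)
  have "ennreal (\<integral>x. \<bar>s x - t i x\<bar> \<partial>M) < ennreal e"
    using i s ti by (subst nn_integral_eq_integral[symmetric]) auto
  then have "(\<integral>x. \<bar>s x - t i x\<bar> \<partial>M) < e" using e by (simp add: ennreal_less_iff)
  then show ?thesis using that sf ti by blast
qed

text \<open>The cells are the level sets of the function that lists all values \<open>f i x\<close>.
  This function is simple, so its range can be numbered, and on each cell all the \<open>f i\<close>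
  are constant simultaneously.\<close>

lemma simple_functions_partition:
  fixes f :: "nat \<Rightarrow> 'a \<Rightarrow> 'b"
  assumes f: "\<And>i. i < m \<Longrightarrow> simple_function M (f i)"
  obtains N :: nat and A where "disjoint_family_on A {..<N}" "\<And>j. j < N \<Longrightarrow> A j \<in> sets M"
    "space M = (\<Union>j<N. A j)"
    "\<And>i j x y. i < m \<Longrightarrow> j < N \<Longrightarrow> x \<in> A j \<Longrightarrow> y \<in> A j \<Longrightarrow> f i x = f i y"
proof -
  define L where "L = (\<lambda>x. map (\<lambda>i. f i x) [0..<m])"
  have L: "simple_function M L"
    using f unfolding L_def
  proof (induction m)
    case (Suc m)
    have "simple_function M (\<lambda>x. map (\<lambda>i. f i x) [0..<m] @ [f m x])"
      using Suc by (intro simple_function_compose2[where h="\<lambda>l y. l @ [y]"]) auto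
    then show ?case by simp
  qed simp
  define N where "N = card (L ` space M)"
  obtain e where e: "bij_betw e {..<N} (L ` space M)"
    using ex_bij_betw_nat_finite[OF simple_functionD(1)[OF L]] unfolding N_def atLeast0LessThan by blast
  define A where "A = (\<lambda>j. L -` {e j} \<inter> space M)"
  show ?thesis
  proof
    show "disjoint_family_on A {..<N}"
      using e by (auto simp: disjoint_family_on_def A_def bij_betw_def inj_on_def)
    show "A j \<in> sets M" if "j < N" for j
      unfolding A_def using L by (rule simple_functionD(2))
    show "space M = (\<Union>j<N. A j)"
      using e by (force simp: A_def bij_betw_def)
    show "f i x = f i y" if "i < m" "j < N" "x \<in> A j" "y \<in> A j" for i j x y
    proof -
      have "L x ! i = L y ! i" using that by (simp add: A_def)
      then show ?thesis using that by (simp add: L_def)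
    qed
  qed
qed

text \<open>Coefficients obtained by integrating against simple \<open>h i\<close> can later be
  computed from integrals over cells alone. The system grows by at most one pair for each new
  function: a \<open>g n\<close> that is already reproduced adds nothing, so linear dependence does
  no harm.\<close>

lemma finite_span_dual_system:
  fixes g :: "nat \<Rightarrow> 'a \<Rightarrow> real"
  assumes g: "\<And>i. i < n \<Longrightarrow> integrable M (g i)"
  obtains m :: nat and h s :: "nat \<Rightarrow> 'a \<Rightarrow> real"
  where "\<And>i. i < m \<Longrightarrow> simple_function M (h i)" "\<And>i. i < m \<Longrightarrow> integrable M (s i)"
    "\<And>c. AE x in M. (\<Sum>j<n. c j * g j x) = (\<Sum>i<m. (\<integral>y. h i y * (\<Sum>j<n. c j * g j y) \<partial>M) * s i x)"
  using g
proof (induction n arbitrary: thesis)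
  case 0
  show ?case by (rule 0(1)[of 0]) auto
next
  case (Suc n)
  have gi: "integrable M (g i)" if "i < Suc n" for i using Suc.prems(2) that .
  obtain m and h s :: "nat \<Rightarrow> 'a \<Rightarrow> real" where
    h: "\<And>i. i < m \<Longrightarrow> simple_function M (h i)" and s: "\<And>i. i < m \<Longrightarrow> integrable M (s i)"
    and id: "\<And>c. AE x in M. (\<Sum>j<n. c j * g j x) = (\<Sum>i<m. (\<integral>y. h i y * (\<Sum>j<n. c j * g j y) \<partial>M) * s i x)"
  proof (rule Suc.IH)
    show "integrable M (g i)" if "i < n" for i using gi that by simp
  qed (rule that)
  \<comment> \<open>By the induction hypothesis \<open>P\<close> fixes the span of the first
    \<open>n\<close> functions up to null sets; \<open>r\<close> is what it misses of the last
    one.\<close>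
  define P where "P = (\<lambda>v x. \<Sum>i<m. (\<integral>y. h i y * v y \<partial>M) * s i x)"
  define r where "r = (\<lambda>x. g n x - P (g n) x)"
  have P_int: "integrable M (P v)" for v
    unfolding P_def using s by (intro Bochner_Integration.integrable_sum) auto
  have r_int: "integrable M r" unfolding r_def using P_int gi[of n] by auto
  have w_int: "integrable M (\<lambda>x. \<Sum>j<n. c j * g j x)" for c :: "nat \<Rightarrow> real"
    using gi by (intro Bochner_Integration.integrable_sum) auto
  have P_v: "P (\<lambda>x. \<Sum>j<Suc n. c j * g j x) x = P (\<lambda>x. \<Sum>j<n. c j * g j x) x + c n * P (g n) x" for c x
  proof -
    have "(\<integral>y. h i y * (\<Sum>j<Suc n. c j * g j y) \<partial>M)
      = (\<integral>y. h i y * (\<Sum>j<n. c j * g j y) \<partial>M) + c n * (\<integral>y. h i y * g n y \<partial>M)" if "i < m" for i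
    proof -
      have "(\<integral>y. h i y * (\<Sum>j<Suc n. c j * g j y) \<partial>M)
        = (\<integral>y. h i y * (\<Sum>j<n. c j * g j y) + c n * (h i y * g n y) \<partial>M)"
        by (simp add: algebra_simps)
      also have "\<dots> = (\<integral>y. h i y * (\<Sum>j<n. c j * g j y) \<partial>M) + (\<integral>y. c n * (h i y * g n y) \<partial>M)"
        by (intro Bochner_Integration.integral_add integrable_simple_mult[OF h[OF that]] w_int
            integrable_mult_right gi) simp
      finally show ?thesis by simp
    qed
    then show ?thesis
      by (simp add: P_def distrib_right sum.distrib sum_distrib_left mult.assoc)
  qed
  \<comment> \<open>As \<open>P\<close> reproduces the part without \<open>g n\<close>, a vector of
    the larger span differs from its image by \<open>c n\<close> times \<open>r\<close>; only the
    coefficient \<open>c n\<close> remains to be found.\<close>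
  have v_eq: "AE x in M. (\<Sum>j<Suc n. c j * g j x) = P (\<lambda>x. \<Sum>j<Suc n. c j * g j x) x + c n * r x" for c
    using id[of c] unfolding P_v by eventually_elim (simp add: P_def r_def algebra_simps)
  show ?case
  proof (cases "AE x in M. r x = 0")
    case True
    show ?thesis
    proof (rule Suc.prems(1)[of m h s])
      show "AE x in M. (\<Sum>j<Suc n. c j * g j x) = (\<Sum>i<m. (\<integral>y. h i y * (\<Sum>j<Suc n. c j * g j y) \<partial>M) * s i x)" for c
        using v_eq[of c] True by eventually_elim (simp add: P_def)
    qed (use h s in auto)
  next
    case False
    define k where "k = (\<integral>x. \<bar>r x\<bar> \<partial>M)"
    have k: "k \<noteq> 0"
      using False r_int integral_nonneg_eq_0_iff_AE[of M "\<lambda>x. \<bar>r x\<bar>"] by (auto simp: k_def)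
    \<comment> \<open>The sign of \<open>r\<close> takes finitely many values and has integral
      \<open>k\<close> against \<open>r\<close>, so it detects \<open>r\<close>, and division by
      \<open>k\<close> normalises it.\<close>
    define h0 where "h0 = (\<lambda>x. sgn (r x))"
    have [measurable]: "r \<in> borel_measurable M" using r_int by auto
    have h0: "simple_function M h0"
    proof (rule simple_function_borel_measurable)
      have "h0 ` space M \<subseteq> {-1, 0, 1}" by (auto simp: h0_def sgn_if)
      then show "finite (h0 ` space M)" by (rule finite_subset) simp
    qed (simp add: h0_def)
    \<comment> \<open>The wanted functional is v \<mapsto> \<integral> h0 (v - P v) / k. As
      \<open>P v\<close> combines the \<open>s i\<close> with coefficients \<integral> h_i v, its
      share is integration against a combination of the \<open>h i\<close>, so the resulting kernel
      is again simple.\<close>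
    define h1 where "h1 = (\<lambda>x. (h0 x - (\<Sum>i<m. (\<integral>y. h0 y * s i y \<partial>M) * h i x)) / k)"
    have h1: "simple_function M h1"
      unfolding h1_def using h h0
      by (intro simple_function_div simple_function_diff simple_function_sum simple_function_mult) auto
    have h1_int: "(\<integral>y. h1 y * v y \<partial>M) = (\<integral>y. h0 y * (v y - P v y) \<partial>M) / k"
      if v: "integrable M v" for v
    proof -
      have "(\<integral>y. h1 y * v y \<partial>M)
        = (\<integral>y. (h0 y * v y - (\<Sum>i<m. (\<integral>y. h0 y * s i y \<partial>M) * (h i y * v y))) / k \<partial>M)"
        by (simp add: h1_def algebra_simps sum_distrib_left diff_divide_distrib sum_distrib_right)
      also have "\<dots> = ((\<integral>y. h0 y * v y \<partial>M) - (\<Sum>i<m. (\<integral>y. h0 y * s i y \<partial>M) * (\<integral>y. h i y * v y \<partial>M))) / k"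
      proof -
        have int: "integrable M (\<lambda>y. (\<integral>y. h0 y * s i y \<partial>M) * (h i y * v y))" if "i < m" for i
          using integrable_simple_mult[OF h[OF that] v] by (rule integrable_mult_right)
        have "(\<integral>y. (\<Sum>i<m. (\<integral>y. h0 y * s i y \<partial>M) * (h i y * v y)) \<partial>M)
          = (\<Sum>i<m. (\<integral>y. h0 y * s i y \<partial>M) * (\<integral>y. h i y * v y \<partial>M))"
          using int by (subst Bochner_Integration.integral_sum) auto
        moreover have "integrable M (\<lambda>y. \<Sum>i<m. (\<integral>y. h0 y * s i y \<partial>M) * (h i y * v y))"
          using int by (intro Bochner_Integration.integrable_sum) auto
        ultimately show ?thesis
          using integrable_simple_mult[OF h0 v] by (simp add: Bochner_Integration.integral_diff)
      qed
      also have "(\<Sum>i<m. (\<integral>y. h0 y * s i y \<partial>M) * (\<integral>y. h i y * v y \<partial>M)) = (\<integral>y. h0 y * P v y \<partial>M)"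
      proof -
        have "(\<integral>y. h0 y * P v y \<partial>M) = (\<integral>y. (\<Sum>i<m. (\<integral>y. h i y * v y \<partial>M) * (h0 y * s i y)) \<partial>M)"
          by (simp add: P_def sum_distrib_left mult.left_commute)
        also have "\<dots> = (\<Sum>i<m. (\<integral>y. h i y * v y \<partial>M) * (\<integral>y. h0 y * s i y \<partial>M))"
          using integrable_simple_mult[OF h0 s] by simp
        finally show ?thesis by (simp add: mult.commute)
      qed
      also have "(\<integral>y. h0 y * v y \<partial>M) - (\<integral>y. h0 y * P v y \<partial>M) = (\<integral>y. h0 y * (v y - P v y) \<partial>M)"
        using integrable_simple_mult[OF h0 v] integrable_simple_mult[OF h0 P_int[of v]]
        by (simp add: right_diff_distrib)
      finally show ?thesis .
    qed
    have h1_coeff: "(\<integral>y. h1 y * (\<Sum>j<Suc n. c j * g j y) \<partial>M) = c n" for c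
    proof -
      let ?v = "\<lambda>y. \<Sum>j<Suc n. c j * g j y"
      have v: "integrable M ?v" using gi by (intro Bochner_Integration.integrable_sum) auto
      have [measurable]: "h0 \<in> borel_measurable M" "?v \<in> borel_measurable M" "P ?v \<in> borel_measurable M"
        using borel_measurable_simple_function[OF h0] v P_int[of ?v] by auto
      have "(\<integral>y. h0 y * (?v y - P ?v y) \<partial>M) = (\<integral>y. c n * \<bar>r y\<bar> \<partial>M)"
      proof (rule integral_cong_AE)
        show "AE y in M. h0 y * (?v y - P ?v y) = c n * \<bar>r y\<bar>"
          using v_eq[of c] by eventually_elim (simp add: h0_def abs_sgn)
      qed measurable
      then show ?thesis using h1_int[OF v] k by (simp add: k_def)
    qed
    show ?thesis
    proof (rule Suc.prems(1)[of "Suc m" "\<lambda>i. if i < m then h i else h1" "\<lambda>i. if i < m then s i else r"])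
      show "AE x in M. (\<Sum>j<Suc n. c j * g j x) = (\<Sum>i<Suc m. (\<integral>y. (if i < m then h i else h1) y *
        (\<Sum>j<Suc n. c j * g j y) \<partial>M) * (if i < m then s i else r) x)" for c
        using v_eq[of c]
      proof eventually_elim
        case (elim x)
        have "(\<Sum>i<Suc m. (\<integral>y. (if i < m then h i else h1) y * (\<Sum>j<Suc n. c j * g j y) \<partial>M) * (if i < m then s i else r) x)
          = P (\<lambda>x. \<Sum>j<Suc n. c j * g j x) x + (\<integral>y. h1 y * (\<Sum>j<Suc n. c j * g j y) \<partial>M) * r x"
          unfolding P_def sum.lessThan_Suc[of _ m] by (intro arg_cong2[where f="(+)"] sum.cong) auto
        then show ?case using elim unfolding h1_coeff by simp
      qed
    qed (use h h1 s r_int in auto)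
  qed
qed


section \<open>Step functions on a finite partition and the corrected kernels\<close>

lemma integrable_indicator_mult:
  fixes v :: "'a \<Rightarrow> real"
  assumes "A \<in> sets M" "integrable M v"
  shows "integrable M (\<lambda>x. indicator A x * v x)"
  using integrable_mult_indicator[OF assms] by simp

lemma sum_indicator_disjoint_cell:
  fixes f :: "nat \<Rightarrow> real"
  assumes "disjoint_family_on A {..<N}" "j < N" "x \<in> A j"
  shows "(\<Sum>i<N. f i * indicator (A i) x) = f j"
proof -
  have "(\<Sum>i<N. f i * indicator (A i) x) = (\<Sum>i<N. if i = j then f i else 0)"
    using assms by (intro sum.cong) (auto simp: disjoint_family_on_def indicator_def)
  then show ?thesis using assms(2) by simp
qed

text \<open>At each point at most one summand is nonzero, and \<open>F 0 = 0\<close> covers the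
  points outside all cells. It is meant for the absolute value and its powers, to compute norms of
  step functions.\<close>

lemma apply_sum_indicator_disjoint:
  fixes F :: "real \<Rightarrow> real" and c :: "nat \<Rightarrow> real"
  assumes "disjoint_family_on A {..<N}" "F 0 = 0"
  shows "F (\<Sum>j<N. c j * indicator (A j) x) = (\<Sum>j<N. F (c j) * indicator (A j) x)"
proof (cases "\<exists>j<N. x \<in> A j")
  case True
  then obtain j where "j < N" "x \<in> A j" by blast
  then show ?thesis by (simp only: sum_indicator_disjoint_cell[OF assms(1)])
qed (use assms(2) in simp)

text \<open>
  The kernels \<open>w\<^sub>j\<close> are the normalised indicators \<open>1\<^bsub>A\<^sub>j\<^esub> / \<mu>(A\<^sub>j)\<close>, corrected
  so that the conditional expectation onto the partition becomes the identity on the span of the \<open>g\<close>s.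
  The correction is small in \<open>L\<^sub>1\<close> because the dual system is fixed before the partition is refined.
\<close>

lemma (in prob_space) finite_span_partition_kernel:
  fixes g :: "nat \<Rightarrow> 'a \<Rightarrow> real"
  assumes g: "\<And>i. i < n \<Longrightarrow> integrable M (g i)" and e: "0 < e"
  obtains N :: nat and A :: "nat \<Rightarrow> 'a set" and w :: "nat \<Rightarrow> 'a \<Rightarrow> real"
  where "disjoint_family_on A {..<N}" "\<And>j. j < N \<Longrightarrow> A j \<in> sets M" "space M = (\<Union>j<N. A j)"
    "\<And>j. j < N \<Longrightarrow> integrable M (w j)" "\<And>j. j < N \<Longrightarrow> (\<integral>x. \<bar>w j x\<bar> \<partial>M) \<le> 1 + e"
    "\<And>c. AE x in M. (\<Sum>i<n. c i * g i x) =
      (\<Sum>j<N. (\<integral>y. indicator (A j) y * (\<Sum>i<n. c i * g i y) \<partial>M) * w j x)"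
proof -
  obtain m and h s :: "nat \<Rightarrow> 'a \<Rightarrow> real" where
    h: "\<And>i. i < m \<Longrightarrow> simple_function M (h i)" and s: "\<And>i. i < m \<Longrightarrow> integrable M (s i)"
    and id: "\<And>c. AE x in M. (\<Sum>j<n. c j * g j x) = (\<Sum>i<m. (\<integral>y. h i y * (\<Sum>j<n. c j * g j y) \<partial>M) * s i x)"
    using finite_span_dual_system[of n M g] g by blast
  have "\<exists>D. 0 \<le> D \<and> (\<forall>i<m. \<forall>x\<in>space M. \<bar>h i x\<bar> \<le> D)"
  proof -
    have "\<exists>B. 0 \<le> B \<and> (\<forall>x\<in>space M. \<bar>h i x\<bar> \<le> B)" if "i < m" for i
      using simple_function_bounded[OF h[OF that]] by metis
    then obtain B where B: "\<And>i. i < m \<Longrightarrow> 0 \<le> B i" "\<And>i x. i < m \<Longrightarrow> x \<in> space M \<Longrightarrow> \<bar>h i x\<bar> \<le> B i"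
      by metis
    have "\<bar>h i x\<bar> \<le> (\<Sum>i<m. B i)" if "i < m" "x \<in> space M" for i x
      using B that member_le_sum[of i "{..<m}" B] by force
    moreover have "0 \<le> (\<Sum>i<m. B i)" using B by (intro sum_nonneg) auto
    ultimately show ?thesis by blast
  qed
  then obtain D where D: "0 \<le> D" "\<And>i x. i < m \<Longrightarrow> x \<in> space M \<Longrightarrow> \<bar>h i x\<bar> \<le> D" by blast
  \<comment> \<open>Each kernel is corrected by \<open>m\<close> terms, each with a factor at most
    \<open>D\<close> and an L_1 norm at most \<open>2 * \<delta>\<close>. The 1 in the denominator
    keeps it positive when \<open>m * D\<close> is zero.\<close>
  define \<delta> where "\<delta> = e / (2 * (m * D + 1))"
  have \<delta>: "\<delta> > 0" "m * D * (2 * \<delta>) \<le> e"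
    using e D(1) by (auto simp: \<delta>_def field_simps add_nonneg_pos add_pos_nonneg)
  have "\<exists>t. simple_function M t \<and> integrable M t \<and> (\<integral>x. \<bar>s i x - t x\<bar> \<partial>M) < \<delta>" if "i < m" for i
    using simple_function_approximation[OF s[OF that] \<delta>(1)] by metis
  then obtain t where t: "\<And>i. i < m \<Longrightarrow> simple_function M (t i)" "\<And>i. i < m \<Longrightarrow> integrable M (t i)"
    "\<And>i. i < m \<Longrightarrow> (\<integral>x. \<bar>s i x - t i x\<bar> \<partial>M) < \<delta>" by metis
  \<comment> \<open>The partition has to make the \<open>h i\<close> and the approximants
    \<open>t i\<close> constant at once: the former for reading off coefficients, the latter for
    approximating the \<open>s i\<close>.\<close>
  have ht: "simple_function M (\<lambda>x. (h i x, t i x))" if "i < m" for i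
    using h[OF that] t(1)[OF that] by (rule simple_function_Pair)
  obtain N :: nat and A where disj: "disjoint_family_on A {..<N}" and A: "\<And>j. j < N \<Longrightarrow> A j \<in> sets M"
    and cover: "space M = (\<Union>j<N. A j)"
    and const: "\<And>i j x y. i < m \<Longrightarrow> j < N \<Longrightarrow> x \<in> A j \<Longrightarrow> y \<in> A j \<Longrightarrow> (h i x, t i x) = (h i y, t i y)"
    using simple_functions_partition[of m M "\<lambda>i x. (h i x, t i x)", OF ht] by metis
  note [measurable] = A
  \<comment> \<open>Values on the cells, with default 0 on an empty cell so that the bound by
    \<open>D\<close> holds there too.\<close>
  define d where "d = (\<lambda>i j. if A j = {} then 0 else h i (SOME x. x \<in> A j))"
  define \<tau> where "\<tau> = (\<lambda>i j. if A j = {} then 0 else t i (SOME x. x \<in> A j))"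
  have d: "h i x = d i j" "t i x = \<tau> i j" if "i < m" "j < N" "x \<in> A j" for i j x
    using const[OF that(1,2,3) someI[of "\<lambda>x. x \<in> A j", OF that(3)]] that(3) by (auto simp: d_def \<tau>_def)
  have d_le: "\<bar>d i j\<bar> \<le> D" if "i < m" "j < N" for i j
  proof (cases "A j = {}")
    case False
    then obtain x where "x \<in> A j" by blast
    then show ?thesis using d(1)[of i j x] D(2)[of i x] that cover by auto
  qed (simp add: d_def D)
  have split: "(\<integral>x. v x \<partial>M) = (\<Sum>j<N. \<integral>x. indicator (A j) x * v x \<partial>M)" if v: "integrable M v" for v :: "'a \<Rightarrow> real"
  proof -
    have "(\<integral>x. v x \<partial>M) = (\<integral>x. (\<Sum>j<N. indicator (A j) x * v x) \<partial>M)"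
    proof (rule Bochner_Integration.integral_cong)
      fix x assume "x \<in> space M"
      then obtain j where "j < N" "x \<in> A j" using cover by blast
      from sum_indicator_disjoint_cell[OF disj this, of "\<lambda>_. v x"] show "v x = (\<Sum>j<N. indicator (A j) x * v x)" by (simp add: mult.commute)
    qed simp
    also have "\<dots> = (\<Sum>j<N. \<integral>x. indicator (A j) x * v x \<partial>M)"
      using integrable_indicator_mult[OF A v] by (intro Bochner_Integration.integral_sum) auto
    finally show ?thesis .
  qed
  define a where "a = (\<lambda>j (v :: 'a \<Rightarrow> real). \<integral>y. indicator (A j) y * v y \<partial>M)"
  \<comment> \<open>The conditional expectation onto the partition, a contraction in L_1. On a null
    cell division by zero makes the coefficient 0, so step functions are reproduced only almost
    everywhere.\<close>
  define E where "E = (\<lambda>v x. \<Sum>j<N. (a j v / measure M (A j)) * indicator (A j) x)"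
  have ind: "integrable M (\<lambda>x. indicator (A j) x :: real)" if "j < N" for j
    using A[OF that] by (simp add: emeasure_eq_measure)
  have E_int: "integrable M (E v)" for v
    unfolding E_def using ind by (intro Bochner_Integration.integrable_sum integrable_mult_right) auto
  have E_contr: "(\<integral>x. \<bar>E v x\<bar> \<partial>M) \<le> (\<integral>x. \<bar>v x\<bar> \<partial>M)" if v: "integrable M v" for v
  proof -
    have "(\<integral>x. \<bar>E v x\<bar> \<partial>M) = (\<integral>x. (\<Sum>j<N. \<bar>a j v / measure M (A j)\<bar> * indicator (A j) x) \<partial>M)"
      unfolding E_def by (simp only: apply_sum_indicator_disjoint[where F=abs, OF disj abs_zero])
    also have "\<dots> = (\<Sum>j<N. \<bar>a j v / measure M (A j)\<bar> * measure M (A j))"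
      using ind A by (subst Bochner_Integration.integral_sum) (auto simp: emeasure_eq_measure)
    also have "\<dots> \<le> (\<Sum>j<N. \<integral>x. indicator (A j) x * \<bar>v x\<bar> \<partial>M)"
    proof (rule sum_mono)
      fix j assume "j \<in> {..<N}"
      then have "\<bar>a j v\<bar> \<le> (\<integral>x. indicator (A j) x * \<bar>v x\<bar> \<partial>M)"
        unfolding a_def by (intro order_trans[OF integral_abs_bound]) (simp add: abs_mult)
      moreover have "0 \<le> (\<integral>x. indicator (A j) x * \<bar>v x\<bar> \<partial>M)" by (intro Bochner_Integration.integral_nonneg) auto
      ultimately show "\<bar>a j v / measure M (A j)\<bar> * measure M (A j) \<le> (\<integral>x. indicator (A j) x * \<bar>v x\<bar> \<partial>M)"
        by (cases "measure M (A j) = 0") auto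
    qed
    also have "\<dots> = (\<integral>x. \<bar>v x\<bar> \<partial>M)" using v by (intro split[symmetric]) auto
    finally show ?thesis .
  qed
  have E_t: "AE x in M. E (t i) x = t i x" if i: "i < m" for i
  proof -
    have "AE x in M. \<forall>j\<in>{..<N}. measure M (A j) = 0 \<longrightarrow> x \<notin> A j"
    proof (rule AE_finite_allI)
      fix j assume "j \<in> {..<N}"
      then have "A j \<in> null_sets M" if "measure M (A j) = 0"
        using A that by (auto simp: null_sets_def emeasure_eq_measure)
      then show "AE x in M. measure M (A j) = 0 \<longrightarrow> x \<notin> A j" using AE_not_in by auto
    qed simp
    then show ?thesis
    proof (rule AE_mp, intro AE_I2 impI)
      fix x assume x: "x \<in> space M" and nz: "\<forall>j\<in>{..<N}. measure M (A j) = 0 \<longrightarrow> x \<notin> A j"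
      obtain j where j: "j < N" "x \<in> A j" using x cover by blast
      have "a j (t i) = (\<integral>y. \<tau> i j * indicator (A j) y \<partial>M)"
        unfolding a_def using d(2)[OF i j(1)]
        by (intro Bochner_Integration.integral_cong) (auto simp: indicator_def)
      also have "\<dots> = \<tau> i j * measure M (A j)" using A[OF j(1)] by simp
      moreover have "E (t i) x = a j (t i) / measure M (A j)"
        unfolding E_def by (rule sum_indicator_disjoint_cell[OF disj j])
      ultimately show "E (t i) x = t i x" using nz j d(2)[OF i j(1,2)] by auto
    qed
  qed
  define q where "q = (\<lambda>i x. s i x - E (s i) x)"
  have q_int: "integrable M (q i)" if "i < m" for i unfolding q_def using s[OF that] E_int by auto
  \<comment> \<open>As \<open>E\<close> fixes \<open>t i\<close> almost everywhere, the residual of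
    \<open>s i\<close> is that of \<open>s i - t i\<close>; contractivity of \<open>E\<close> bounds
    it by twice the norm of this difference.\<close>
  have q_small: "(\<integral>x. \<bar>q i x\<bar> \<partial>M) \<le> 2 * \<delta>" if i: "i < m" for i
  proof -
    have a_diff: "a j (\<lambda>x. s i x - t i x) = a j (s i) - a j (t i)" if "j < N" for j
      using integrable_indicator_mult[OF A[OF that] s[OF i]] integrable_indicator_mult[OF A[OF that] t(2)[OF i]]
      by (simp add: a_def right_diff_distrib)
    have E_diff: "E (\<lambda>x. s i x - t i x) x = E (s i) x - E (t i) x" for x
      unfolding E_def sum_subtractf[symmetric]
      by (intro sum.cong) (auto simp: a_diff diff_divide_distrib left_diff_distrib)
    have st: "integrable M (\<lambda>x. s i x - t i x)" using s t i by auto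
    have "(\<integral>x. \<bar>q i x\<bar> \<partial>M) \<le> (\<integral>x. \<bar>s i x - t i x\<bar> + \<bar>E (\<lambda>x. s i x - t i x) x\<bar> \<partial>M)"
    proof (rule integral_mono_AE)
      show "AE x in M. \<bar>q i x\<bar> \<le> \<bar>s i x - t i x\<bar> + \<bar>E (\<lambda>x. s i x - t i x) x\<bar>"
        using E_t[OF i] by eventually_elim (simp add: q_def E_diff)
    qed (use q_int[OF i] st E_int in auto)
    also have "\<dots> = (\<integral>x. \<bar>s i x - t i x\<bar> \<partial>M) + (\<integral>x. \<bar>E (\<lambda>x. s i x - t i x) x\<bar> \<partial>M)"
      using st E_int by (intro Bochner_Integration.integral_add) auto
    also have "\<dots> \<le> \<delta> + \<delta>"
      using t(3)[OF i] E_contr[OF st] by simp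
    finally show ?thesis by simp
  qed
  \<comment> \<open>For v = \<Sum> b_i s_i the defect v - E v is \<Sum> b_i q_i, and b_i is the sum
    over j of \<open>d i j\<close> times the integral of v over \<open>A j\<close>, because
    \<open>h i\<close> has the value \<open>d i j\<close> there. Exchanging the two sums attaches
    the correction to the normalised indicator of each cell.\<close>
  define w where "w = (\<lambda>j x. indicator (A j) x / measure M (A j) + (\<Sum>i<m. d i j * q i x))"
  show ?thesis
  proof (rule that[of A N w])
    show "integrable M (w j)" if "j < N" for j
      unfolding w_def using q_int ind[OF that]
      by (intro Bochner_Integration.integrable_add Bochner_Integration.integrable_sum integrable_mult_right) auto
    show "(\<integral>x. \<bar>w j x\<bar> \<partial>M) \<le> 1 + e" if j: "j < N" for j
    proof -
      have i1: "integrable M (\<lambda>x. indicator (A j) x / measure M (A j))" using ind[OF j] by simp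
      have i2: "integrable M (\<lambda>x. D * \<bar>q i x\<bar>)" if "i < m" for i using q_int[OF that] by simp
      have i3: "integrable M (\<lambda>x. \<Sum>i<m. D * \<bar>q i x\<bar>)" using i2 by (intro Bochner_Integration.integrable_sum) auto
      have "(\<integral>x. \<bar>w j x\<bar> \<partial>M) \<le> (\<integral>x. indicator (A j) x / measure M (A j) + (\<Sum>i<m. D * \<bar>q i x\<bar>) \<partial>M)"
      proof (rule integral_mono)
        fix x
        have "\<bar>w j x\<bar> \<le> \<bar>indicator (A j) x / measure M (A j)\<bar> + \<bar>\<Sum>i<m. d i j * q i x\<bar>"
          unfolding w_def by (rule abs_triangle_ineq)
        also have "\<dots> \<le> indicator (A j) x / measure M (A j) + (\<Sum>i<m. D * \<bar>q i x\<bar>)"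
          using d_le j by (intro add_mono order_trans[OF sum_abs] sum_mono) (auto simp: abs_mult intro!: mult_right_mono)
        finally show "\<bar>w j x\<bar> \<le> indicator (A j) x / measure M (A j) + (\<Sum>i<m. D * \<bar>q i x\<bar>)" .
      qed (use \<open>j < N \<Longrightarrow> integrable M (w j)\<close> j i1 i3 in auto)
      also have "\<dots> = measure M (A j) / measure M (A j) + (\<Sum>i<m. D * (\<integral>x. \<bar>q i x\<bar> \<partial>M))"
        using i1 i3 i2 A[OF j] by simp
      \<comment> \<open>The quotient is 1, except on a null cell, where it is 0.\<close>
      also have "\<dots> \<le> 1 + (\<Sum>i<m. D * (2 * \<delta>))"
        using q_small D(1) by (intro add_mono sum_mono mult_left_mono) (auto simp: divide_le_eq_1)
      also have "\<dots> \<le> 1 + e" using \<delta>(2) by (simp add: mult.assoc)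
      finally show ?thesis .
    qed
    fix c :: "nat \<Rightarrow> real"
    define v where "v = (\<lambda>x. \<Sum>i<n. c i * g i x)"
    define b where "b = (\<lambda>i. \<integral>y. h i y * v y \<partial>M)"
    have v: "integrable M v"
      unfolding v_def using g by (intro Bochner_Integration.integrable_sum integrable_mult_right) auto
    have idv: "AE x in M. v x = (\<Sum>i<m. b i * s i x)" using id[of c] by (simp add: v_def b_def)
    have av: "a j v = (\<Sum>i<m. b i * a j (s i))" if j: "j < N" for j
    proof -
      have "a j v = (\<integral>y. (\<Sum>i<m. b i * (indicator (A j) y * s i y)) \<partial>M)"
        unfolding a_def
      proof (rule integral_cong_AE)
        show "AE x in M. indicator (A j) x * v x = (\<Sum>i<m. b i * (indicator (A j) x * s i x))"
          using idv by eventually_elim (simp add: sum_distrib_left mult.left_commute)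
        show "(\<lambda>x. indicator (A j) x * v x) \<in> borel_measurable M" using v A[OF j] by measurable
        show "(\<lambda>x. \<Sum>i<m. b i * (indicator (A j) x * s i x)) \<in> borel_measurable M"
          using borel_measurable_integrable[OF s] A[OF j]
          by (intro borel_measurable_sum borel_measurable_times) auto
      qed
      also have "\<dots> = (\<Sum>i<m. b i * a j (s i))"
        using integrable_indicator_mult[OF A[OF j] s] by (simp add: a_def)
      finally show ?thesis .
    qed
    have bv: "b i = (\<Sum>j<N. a j v * d i j)" if i: "i < m" for i
    proof -
      have "b i = (\<Sum>j<N. \<integral>y. indicator (A j) y * (h i y * v y) \<partial>M)"
        unfolding b_def by (rule split[OF integrable_simple_mult[OF h[OF i] v]])
      also have "\<dots> = (\<Sum>j<N. a j v * d i j)"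
      proof (rule sum.cong)
        fix j assume j: "j \<in> {..<N}"
        have "(\<integral>y. indicator (A j) y * (h i y * v y) \<partial>M) = (\<integral>y. (indicator (A j) y * v y) * d i j \<partial>M)"
          using d(1)[OF i] j by (intro Bochner_Integration.integral_cong) (auto simp: indicator_def)
        then show "(\<integral>y. indicator (A j) y * (h i y * v y) \<partial>M) = a j v * d i j" by (simp add: a_def)
      qed simp
      finally show ?thesis .
    qed
    have "AE x in M. v x = (\<Sum>j<N. a j v * w j x)"
      using idv
    proof eventually_elim
      case (elim x)
      have "(\<Sum>j<N. a j v * w j x) = E v x + (\<Sum>j<N. \<Sum>i<m. (a j v * d i j) * q i x)"
        by (simp add: w_def E_def distrib_left sum.distrib sum_distrib_left mult.assoc)
      also have "(\<Sum>j<N. \<Sum>i<m. (a j v * d i j) * q i x) = (\<Sum>i<m. b i * q i x)"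
        by (subst sum.swap) (simp add: bv sum_distrib_right)
      also have "E v x = (\<Sum>i<m. b i * E (s i) x)"
        unfolding E_def sum_distrib_left
        by (subst sum.swap) (auto simp: av sum_divide_distrib sum_distrib_right mult.assoc intro!: sum.cong)
      also have "(\<Sum>i<m. b i * E (s i) x) + (\<Sum>i<m. b i * q i x) = (\<Sum>i<m. b i * s i x)"
        by (simp add: q_def right_diff_distrib sum_subtractf)
      finally show ?case using elim by simp
    qed
    then show "AE x in M. (\<Sum>i<n. c i * g i x) =
      (\<Sum>j<N. (\<integral>y. indicator (A j) y * (\<Sum>i<n. c i * g i y) \<partial>M) * w j x)"
      by (simp add: v_def a_def)
  qed (use disj A cover in auto)
qed

subsection \<open>Nuclear representations\<close>

text \<open>The converse of Hoelder's inequality for a finitely supported sequence: unit vectors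
  test the entries when p = 1, and one extremal sequence attains the norm otherwise. It reduces
  weak-norm estimates to bounds for finite linear combinations.\<close>

lemma seq_norm_conj_le:
  assumes p: "1 \<le> p" "p < \<infinity>" and C: "0 \<le> C" and zero: "\<And>j. N \<le> j \<Longrightarrow> a j = 0"
    and dual: "\<And>b. \<bar>\<Sum>j<N. b j * a j\<bar> \<le> C * (\<Sum>j<N. \<bar>b j\<bar> powr real_of_ereal p) powr (1 / real_of_ereal p)"
  shows "seq_norm (conj_exp p) a \<le> ennreal C"
  using p
proof (cases rule: conj_exp_cases)
  case one
  have "\<bar>a n\<bar> \<le> C" for n
  proof (cases "n < N")
    case True
    then show ?thesis
      using dual[of "\<lambda>j. if j = n then 1 else 0"]
      by (simp add: one if_distrib[of "\<lambda>z. z * _"] if_distrib[of abs] if_distrib[of "\<lambda>z. z powr _"] cong: if_cong)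
  qed (use zero C in auto)
  then show ?thesis by (auto simp: one(2) seq_norm_def intro!: SUP_least ennreal_leI)
next
  case (gt P Q)
  define s where "s = (\<Sum>j<N. \<bar>a j\<bar> powr Q)"
  have s0: "s \<ge> 0" unfolding s_def by (intro sum_nonneg) auto
  have sums: "(\<lambda>j. \<bar>a j\<bar> powr Q) sums s"
    unfolding s_def by (rule sums_finite) (use zero gt in auto)
  \<comment> \<open>The extremal sequence: b_j a_j and |b_j|^P both equal |a_j|^Q, so the hypothesis
    reads s \<le> C s^(1/P), and cancelling s^(1/P) leaves s^(1/Q) \<le> C.\<close>
  define b where "b = (\<lambda>j. sgn (a j) * \<bar>a j\<bar> powr (Q - 1))"
  have ba: "b j * a j = \<bar>a j\<bar> powr Q" for j
  proof -
    have "b j * a j = \<bar>a j\<bar> powr (Q - 1) * \<bar>a j\<bar> powr 1"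
      by (cases "0 \<le> a j") (auto simp: b_def sgn_if)
    then show ?thesis by (simp add: powr_add[symmetric] del: powr_one powr_one')
  qed
  have bP: "\<bar>b j\<bar> powr P = \<bar>a j\<bar> powr Q" for j
    using gt by (cases "a j = 0") (auto simp: b_def abs_mult powr_powr abs_sgn_eq)
  have "s \<le> C * s powr (1 / P)"
    using dual[of b] s0 by (simp add: ba bP gt(1) s_def[symmetric])
  moreover have "s = s powr (1 / Q) * s powr (1 / P)" if "s \<noteq> 0"
    using that s0 gt by (simp add: powr_add[symmetric] add.commute)
  ultimately have "s powr (1 / Q) * s powr (1 / P) \<le> C * s powr (1 / P)" if "s \<noteq> 0"
    using that by simp
  then have "s powr (1 / Q) \<le> C"
    using C s0 by (cases "s = 0") (auto simp: mult_le_cancel_right)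
  then show ?thesis
    using sums gt(2) by (simp add: seq_norm_def sums_iff ennreal_leI)
qed

context prob_space
begin

text \<open>The combination is the integral of \<open>v\<close> against the step function with value
  b_j \<mu>(A_j)^(-1/P) on A_j. The exponent -1/P makes the P-th power of this value, times
  \<mu>(A_j), equal to |b_j|^P on cells of positive measure; Hoelder's inequality does the
  rest.\<close>

lemma partition_functional_bound:
  fixes P :: real and N :: nat
  assumes P: "1 \<le> P" and disj: "disjoint_family_on A {..<N}" and A: "\<And>j. j < N \<Longrightarrow> A j \<in> sets M"
    and v: "v \<in> Lq_fun M (conj_exp (ereal P))"
  shows "\<bar>\<Sum>j<N. b j * (measure M (A j) powr (- 1 / P) * (\<integral>x. indicator (A j) x * v x \<partial>M))\<bar>
    \<le> Lq_norm M (conj_exp (ereal P)) v * (\<Sum>j<N. \<bar>b j\<bar> powr P) powr (1 / P)"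
proof -
  have p: "1 \<le> ereal P" "ereal P < \<infinity>" using P by (auto simp: one_ereal_def)
  have vi: "integrable M v" by (rule Lq_conj_subset_L1[OF p v])
  define c where "c = (\<lambda>j. b j * measure M (A j) powr (- 1 / P))"
  define f where "f = (\<lambda>x. \<Sum>j<N. c j * indicator (A j) x)"
  have fm: "f \<in> borel_measurable M"
    unfolding f_def using A by (intro borel_measurable_sum borel_measurable_times) auto
  have ind: "integrable M (\<lambda>x. indicator (A j) x :: real)" if "j < N" for j
    using A[OF that] by (simp add: emeasure_eq_measure)
  have fP: "\<bar>f x\<bar> powr P = (\<Sum>j<N. \<bar>c j\<bar> powr P * indicator (A j) x)" for x
    unfolding f_def by (rule apply_sum_indicator_disjoint[where F="\<lambda>z. \<bar>z\<bar> powr P", OF disj]) simp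
  have fP_int: "integrable M (\<lambda>x. \<bar>f x\<bar> powr P)"
    unfolding fP using ind by (intro Bochner_Integration.integrable_sum integrable_mult_right) auto
  then have f: "f \<in> Lq_fun M (ereal P)" using fm by (simp add: Lq_fun_def)
  \<comment> \<open>Only an inequality, because the term of a null cell is lost.\<close>
  have cell: "\<bar>c j\<bar> powr P * measure M (A j) \<le> \<bar>b j\<bar> powr P" for j
  proof (cases "measure M (A j) = 0")
    case False
    have "\<bar>c j\<bar> powr P = \<bar>b j\<bar> powr P * measure M (A j) powr (- 1)"
      using P by (simp add: c_def abs_mult powr_mult powr_powr)
    then show ?thesis using False by (simp add: powr_minus_divide)
  qed simp
  have "(\<integral>x. \<bar>f x\<bar> powr P \<partial>M) = (\<Sum>j<N. \<bar>c j\<bar> powr P * measure M (A j))"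
    unfolding fP using ind A by (subst Bochner_Integration.integral_sum) auto
  also have "\<dots> \<le> (\<Sum>j<N. \<bar>b j\<bar> powr P)" by (intro sum_mono cell)
  finally have f_norm: "Lq_norm M (ereal P) f \<le> (\<Sum>j<N. \<bar>b j\<bar> powr P) powr (1 / P)"
    using P by (auto simp: Lq_norm_def intro!: powr_mono2 Bochner_Integration.integral_nonneg)
  have "(\<Sum>j<N. b j * (measure M (A j) powr (- 1 / P) * (\<integral>x. indicator (A j) x * v x \<partial>M)))
    = (\<integral>x. (\<Sum>j<N. c j * (indicator (A j) x * v x)) \<partial>M)"
    using integrable_indicator_mult[OF A vi] by (subst Bochner_Integration.integral_sum) (auto simp: c_def mult.assoc)
  also have "\<dots> = (\<integral>x. f x * v x \<partial>M)"
    by (simp only: f_def sum_distrib_right mult.assoc)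
  also have "\<bar>\<dots>\<bar> \<le> (\<integral>x. \<bar>f x * v x\<bar> \<partial>M)" by (rule integral_abs_bound)
  also have "\<dots> \<le> Lq_norm M (ereal P) f * Lq_norm M (conj_exp (ereal P)) v"
    by (rule Hoelder(2)[OF p f v])
  also have "\<dots> \<le> (\<Sum>j<N. \<bar>b j\<bar> powr P) powr (1 / P) * Lq_norm M (conj_exp (ereal P)) v"
    using f_norm v by (intro mult_right_mono Lq_norm_nonneg) (auto intro: Lq_fun_measurable)
  finally show ?thesis by (simp add: mult.commute)
qed

text \<open>The loss \<open>1 + e\<close> comes from the L_1 norms of the kernels and so falls on
  \<open>u\<close> alone; the weak norm of the functionals is bounded by the norm of
  \<open>S\<close> without loss.\<close>

lemma pos_nuclear_rep_near_optimal:
  fixes Y :: "'y nlattice" and F :: "'f nspace"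
  assumes p: "1 \<le> p" "p < \<infinity>" and Y: "banach_lattice Y" and F: "banach_space F"
    and S: "S \<in> operators Y (Lq M (conj_exp p))" and S_pos: "positive_op Y (Lq M (conj_exp p)) S"
    and S_fin: "finite_rank Y (Lq M (conj_exp p)) S"
    and R: "R \<in> operators (Lq M 1) F" and e: "0 < e"
  obtains xs u where "pos_nuclear_rep p Y F (R \<circ> Lq_incl \<circ> S) xs u"
    "weak_norm (conj_exp p) (dual_space Y) xs * strong_norm p F u
      \<le> ennreal (opnorm (Lq M 1) F R * (1 + e) * opnorm Y (Lq M (conj_exp p)) S)"
proof -
  obtain P where P: "p = ereal P" "1 \<le> P" using p by (cases p) auto
  let ?q = "conj_exp p"
  interpret Y: banach_lattice Y by fact
  interpret F: banach_space F by fact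
  have q1: "1 \<le> ?q" by (rule conj_exp_ge_1[OF p])
  interpret LQ: pre_normed "Lq M ?q" by (rule pre_normed_Lq[OF q1])
  interpret L1: pre_normed "Lq M 1" by (rule pre_normed_Lq) simp
  interpret D: pre_normed "dual_space Y" by (rule pre_normed_dual[OF Y.pre_normed_axioms])
  define \<sigma> where "\<sigma> = opnorm Y (Lq M ?q) S"
  define \<rho> where "\<rho> = opnorm (Lq M 1) F R"
  have \<sigma>: "0 \<le> \<sigma>" unfolding \<sigma>_def by (rule opnorm_nonneg[OF Y.pre_normed_axioms LQ.pre_normed_axioms S])
  have \<rho>: "0 \<le> \<rho>" unfolding \<rho>_def by (rule opnorm_nonneg[OF L1.pre_normed_axioms F.pre_normed_axioms R])
  obtain n b where b: "\<And>i. b i \<in> vcar (Lq M ?q)"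
    and Sb: "\<And>y. y \<in> vcar Y \<Longrightarrow> \<exists>c. S y = vsum (Lq M ?q) (\<lambda>i. vscale (Lq M ?q) (c i) (b i)) n"
    using S_fin unfolding finite_rank_def by blast
  define g where "g = (\<lambda>i. rep (b i))"
  have g: "g i \<in> Lq_fun M ?q" "ae_class M (g i) = b i" for i
    using Lq_carrier[OF b[of i]] by (auto simp: g_def)
  have g_int: "integrable M (g i)" for i by (rule Lq_conj_subset_L1(1)[OF p g(1)])
  have [measurable]: "g i \<in> borel_measurable M" for i using g(1) by (rule Lq_fun_measurable)
  \<comment> \<open>One partition serves all coefficients \<open>c\<close> in \<open>w_id\<close>;
    this matters because the coefficients of \<open>S y\<close> vary with \<open>y\<close>.\<close>
  obtain N :: nat and A and w where disj: "disjoint_family_on A {..<N}"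
    and A: "\<And>j. j < N \<Longrightarrow> A j \<in> sets M" and cover: "space M = (\<Union>j<N. A j)"
    and w: "\<And>j. j < N \<Longrightarrow> integrable M (w j)" "\<And>j. j < N \<Longrightarrow> (\<integral>x. \<bar>w j x\<bar> \<partial>M) \<le> 1 + e"
    and w_id: "\<And>c. AE x in M. (\<Sum>i<n. c i * g i x) =
      (\<Sum>j<N. (\<integral>y. indicator (A j) y * (\<Sum>i<n. c i * g i y) \<partial>M) * w j x)"
    by (rule finite_span_partition_kernel[of n g, OF g_int e]) blast
  \<comment> \<open>\<open>rep\<close> need not respect the operations, so \<open>V\<close> is
    linear only up to null sets. Integration over a cell turns this into exact linearity of
    \<open>\<phi> j\<close>.\<close>
  define V where "V = (\<lambda>y. rep (S y))"
  have V: "V y \<in> Lq_fun M ?q" "ae_class M (V y) = S y" if "y \<in> vcar Y" for y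
    using Lq_carrier[OF operatorsD(1)[OF S that]] by (auto simp: V_def)
  have V_meas: "V y \<in> borel_measurable M" if "y \<in> vcar Y" for y using V(1)[OF that] by (rule Lq_fun_measurable)
  have V_int: "integrable M (V y)" if "y \<in> vcar Y" for y by (rule Lq_conj_subset_L1(1)[OF p V(1)[OF that]])
  have V_norm: "Lq_norm M ?q (V y) \<le> \<sigma> * vnorm Y y" if "y \<in> vcar Y" for y
    using opnorm_bound[OF Y.pre_normed_axioms LQ.pre_normed_axioms S that] by (simp add: V_def \<sigma>_def vnorm_Lq)
  have V_add: "AE x in M. V (vadd Y y z) x = V y x + V z x" if "y \<in> vcar Y" "z \<in> vcar Y" for y z
  proof -
    have "S (vadd Y y z) = ae_class M (\<lambda>x. V y x + V z x)"
      using V_meas that by (simp add: operatorsD(2)[OF S] V(2)[symmetric] vadd_ae_class)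
    then show ?thesis using V_meas that rep_ae_class(2)[of "\<lambda>x. V y x + V z x" M] by (simp add: V_def)
  qed
  have V_scale: "AE x in M. V (vscale Y c y) x = c * V y x" if "y \<in> vcar Y" for c y
  proof -
    have "S (vscale Y c y) = ae_class M (\<lambda>x. c * V y x)"
      using V_meas that by (simp add: operatorsD(3)[OF S] V(2)[symmetric] vscale_ae_class)
    then show ?thesis using V_meas that rep_ae_class(2)[of "\<lambda>x. c * V y x" M] by (simp add: V_def)
  qed
  define \<phi> where "\<phi> = (\<lambda>j y. \<integral>x. indicator (A j) x * V y x \<partial>M)"
  have V_id: "AE x in M. V y x = (\<Sum>j<N. \<phi> j y * w j x)" if y: "y \<in> vcar Y" for y
  proof -
    obtain c where c: "S y = vsum (Lq M ?q) (\<lambda>i. vscale (Lq M ?q) (c i) (b i)) n" using Sb[OF y] by blast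
    have "S y = ae_class M (\<lambda>x. \<Sum>i<n. c i * g i x)"
      unfolding c g(2)[symmetric] by (simp add: vscale_ae_class vsum_ae_class)
    then have ae: "AE x in M. V y x = (\<Sum>i<n. c i * g i x)"
      using rep_ae_class(2)[of "\<lambda>x. \<Sum>i<n. c i * g i x" M] by (simp add: V_def)
    have "\<phi> j y = (\<integral>x. indicator (A j) x * (\<Sum>i<n. c i * g i x) \<partial>M)" if "j < N" for j
      unfolding \<phi>_def
    proof (rule integral_cong_AE)
      show "AE x in M. indicator (A j) x * V y x = indicator (A j) x * (\<Sum>i<n. c i * g i x)"
        using ae by eventually_elim simp
    qed (use A[OF that] V_meas[OF y] in measurable)
    then show ?thesis using ae w_id[of c] by (auto elim: eventually_elim2)
  qed
  have \<phi>_add: "\<phi> j (vadd Y y z) = \<phi> j y + \<phi> j z" if "j < N" "y \<in> vcar Y" "z \<in> vcar Y" for j y z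
  proof -
    have "\<phi> j (vadd Y y z) = (\<integral>x. indicator (A j) x * V y x + indicator (A j) x * V z x \<partial>M)"
      unfolding \<phi>_def
    proof (rule integral_cong_AE)
      show "AE x in M. indicator (A j) x * V (vadd Y y z) x = indicator (A j) x * V y x + indicator (A j) x * V z x"
        using V_add[OF that(2,3)] by eventually_elim (simp add: distrib_left)
    qed (use A[OF that(1)] V_meas[OF that(2)] V_meas[OF that(3)] V_meas[OF Y.add_closed[OF that(2,3)]] in measurable)
    then show ?thesis
      using integrable_indicator_mult[OF A V_int] that by (simp add: \<phi>_def)
  qed
  have \<phi>_scale: "\<phi> j (vscale Y c y) = c * \<phi> j y" if "j < N" "y \<in> vcar Y" for j y c
  proof -
    have "\<phi> j (vscale Y c y) = (\<integral>x. c * (indicator (A j) x * V y x) \<partial>M)"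
      unfolding \<phi>_def
    proof (rule integral_cong_AE)
      show "AE x in M. indicator (A j) x * V (vscale Y c y) x = c * (indicator (A j) x * V y x)"
        using V_scale[OF that(2), of c] by eventually_elim simp
    qed (use A[OF that(1)] V_meas[OF that(2)] V_meas[OF Y.scale_closed[OF that(2)]] in measurable)
    then show ?thesis by (simp add: \<phi>_def)
  qed
  have \<phi>_bound: "\<bar>\<phi> j y\<bar> \<le> \<sigma> * vnorm Y y" if "j < N" "y \<in> vcar Y" for j y
  proof -
    have "\<bar>\<phi> j y\<bar> \<le> (\<integral>x. \<bar>indicator (A j) x * V y x\<bar> \<partial>M)"
      unfolding \<phi>_def by (rule integral_abs_bound)
    also have "\<dots> \<le> (\<integral>x. \<bar>V y x\<bar> \<partial>M)"
      using integrable_indicator_mult[OF A V_int] V_int that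
      by (intro integral_mono) (auto simp: indicator_def)
    also have "\<dots> \<le> \<sigma> * vnorm Y y"
      using Lq_conj_subset_L1(2)[OF p V(1)[OF that(2)]] V_norm[OF that(2)] by simp
    finally show ?thesis .
  qed
  have \<phi>_nonneg: "0 \<le> \<phi> j y" if y: "y \<in> vpos Y" for j y
  proof -
    have "S y \<in> vpos (Lq M ?q)" using S_pos y by (simp add: positive_op_def)
    then have "AE x in M. rep (ae_class M (\<lambda>x. 0)) x \<le> V y x" by (simp add: vpos_def Lq_def V_def)
    then have "AE x in M. 0 \<le> V y x"
      using rep_ae_class(2)[of "\<lambda>x. 0" M, OF borel_measurable_const] by eventually_elim simp
    then have "AE x in M. 0 \<le> indicator (A j) x * V y x" by eventually_elim simp
    then show ?thesis unfolding \<phi>_def by (rule integral_nonneg_AE)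
  qed
  let ?\<mu> = "\<lambda>j. measure M (A j)"
  \<comment> \<open>Both sequences are continued by zero from \<open>N\<close> on, which turns the
    finite sum into a series. The corrected kernels \<open>w j\<close> stand in place of the
    normalised indicators, and \<open>restrict\<close> makes the functionals extensional as the dual
    demands.\<close>
  define xs where "xs = (\<lambda>j. if j < N then restrict (\<lambda>y. ?\<mu> j powr (- 1 / P) * \<phi> j y) (vcar Y) else vzero (dual_space Y))"
  define u where "u = (\<lambda>j. if j < N then vscale F (?\<mu> j powr (1 / P)) (R (ae_class M (w j))) else vzero F)"
  have wL: "ae_class M (w j) \<in> vcar (Lq M 1)" if "j < N" for j
    using w(1)[OF that] by (intro ae_class_in_Lq) (simp add: Lq_fun_1)
  have Rw: "R (ae_class M (w j)) \<in> vcar F" if "j < N" for j using operatorsD(1)[OF R wL[OF that]] .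
  have u_in: "u j \<in> vcar F" for j by (simp add: u_def F.scale_closed F.zero_closed Rw)
  have xs_dual: "xs j \<in> vcar (dual_space Y)" for j
  proof (cases "j < N")
    case True
    have "\<bar>?\<mu> j powr (- 1 / P) * \<phi> j y\<bar> \<le> (?\<mu> j powr (- 1 / P) * \<sigma>) * vnorm Y y" if "y \<in> vcar Y" for y
      using \<phi>_bound[OF True that] by (simp add: abs_mult mult.assoc mult_left_mono)
    then show ?thesis
      unfolding xs_def using True
      by (intro dual_opsI[where K="?\<mu> j powr (- 1 / P) * \<sigma>"])
        (auto simp: Y.add_closed Y.scale_closed \<phi>_add \<phi>_scale distrib_left)
  qed (simp add: xs_def D.zero_closed)
  have xs_pos: "xs j \<in> dual_pos Y" for j
    using xs_dual[of j] \<phi>_nonneg by (auto simp: dual_pos_def xs_def dual_space_def vpos_def)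
  have xs_out: "xs j y = 0" if "N \<le> j" "y \<in> vcar Y" for j y
    using that by (simp add: xs_def dual_space_def)
  have xs_u: "vscale F (xs j y) (u j) = vscale F (\<phi> j y) (R (ae_class M (w j)))" if "j < N" "y \<in> vcar Y" for j y
  proof (cases "?\<mu> j = 0")
    \<comment> \<open>On a null cell both weights are 0 and their product is no longer 1, but
      \<open>\<phi> j y\<close> vanishes there as well.\<close>
    case True
    then have "A j \<in> null_sets M" using A[OF that(1)] by (simp add: null_sets_def emeasure_eq_measure)
    then have "AE x in M. x \<notin> A j" by (rule AE_not_in)
    then have "AE x in M. indicator (A j) x * V y x = 0" by eventually_elim simp
    then have "\<phi> j y = 0" unfolding \<phi>_def by (rule integral_eq_zero_AE)
    then show ?thesis using that by (simp add: xs_def u_def F.scale_scale Rw)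
  next
    case False
    then have "?\<mu> j powr (- 1 / P) * ?\<mu> j powr (1 / P) = 1" by (simp add: powr_add[symmetric])
    moreover have "xs j y * ?\<mu> j powr (1 / P) = (?\<mu> j powr (- 1 / P) * ?\<mu> j powr (1 / P)) * \<phi> j y"
      using that by (simp add: xs_def)
    ultimately have "xs j y * ?\<mu> j powr (1 / P) = \<phi> j y" by (simp only: mult_1)
    then show ?thesis using that by (simp add: u_def F.scale_scale Rw)
  qed
  have factor: "(R \<circ> Lq_incl \<circ> S) y = vsum F (\<lambda>j. vscale F (xs j y) (u j)) k"
    if y: "y \<in> vcar Y" and k: "N \<le> k" for y k
  proof -
    have "S y = ae_class M (\<lambda>x. \<Sum>j<N. \<phi> j y * w j x)"
      unfolding V(2)[OF y, symmetric]
    proof (rule ae_class_eqI[OF V_meas[OF y] _ V_id[OF y]])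
      show "(\<lambda>x. \<Sum>j<N. \<phi> j y * w j x) \<in> borel_measurable M"
        using borel_measurable_integrable[OF w(1)] by (intro borel_measurable_sum borel_measurable_times) auto
    qed
    also have "\<dots> = vsum (Lq M 1) (\<lambda>j. ae_class M (\<lambda>x. \<phi> j y * w j x)) N"
      using borel_measurable_integrable[OF w(1)] by (intro vsum_ae_class[symmetric] borel_measurable_times) auto
    also have "\<dots> = vsum (Lq M 1) (\<lambda>j. vscale (Lq M 1) (\<phi> j y) (ae_class M (w j))) N"
      using borel_measurable_integrable[OF w(1)] by (intro vsum_cong) (simp add: vscale_ae_class)
    finally have "R (S y) = vsum F (\<lambda>j. R (vscale (Lq M 1) (\<phi> j y) (ae_class M (w j)))) N"
      using wL by (simp add: operator_vsum[OF L1.pre_normed_axioms F.pre_normed_axioms R] L1.scale_closed)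
    also have "\<dots> = vsum F (\<lambda>j. vscale F (xs j y) (u j)) N"
      using wL y by (intro vsum_cong) (simp add: operatorsD(3)[OF R] xs_u)
    also have "\<dots> = vsum F (\<lambda>j. vscale F (xs j y) (u j)) k"
      using k y by (intro vsum_extend_zero[symmetric, OF F]) (auto simp: F.scale_closed u_in xs_out F.vscale_0)
    finally show ?thesis by (simp add: Lq_incl_def)
  qed
  \<comment> \<open>From \<open>N\<close> on the partial sums equal the operator, so convergence in
    operator norm is that of an eventually zero sequence.\<close>
  have "opnorm Y F (\<lambda>y. vminus F ((R \<circ> Lq_incl \<circ> S) y) (vsum F (\<lambda>j. vscale F (xs j y) (u j)) k)) = 0"
    if k: "N \<le> k" for k
  proof -
    have "opnorm Y F (\<lambda>y. vminus F ((R \<circ> Lq_incl \<circ> S) y) (vsum F (\<lambda>j. vscale F (xs j y) (u j)) k))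
      = opnorm Y F (\<lambda>y. vzero F)"
      using factor[OF _ k] by (intro opnorm_cong) (simp add: F.minus_self F.vsum_closed F.scale_closed u_in)
    moreover have "{x \<in> vcar Y. vnorm Y x \<le> 1} \<noteq> {}" using Y.zero_closed Y.norm_zero by auto
    ultimately show ?thesis by (simp add: opnorm_def F.norm_zero)
  qed
  then have lim: "(\<lambda>k. opnorm Y F (\<lambda>y. vminus F ((R \<circ> Lq_incl \<circ> S) y) (vsum F (\<lambda>j. vscale F (xs j y) (u j)) k)))
    \<longlonglongrightarrow> 0"
    by (intro tendsto_eventually) (auto simp: eventually_sequentially)
  \<comment> \<open>Two dualities bring the weak norm down to points of Y:
    \<open>seq_norm_conj_le\<close> replaces the sequence norm by finite combinations, and
    \<open>dual_ball_combination\<close> replaces a bidual functional by vectors \<open>y\<close> of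
    the unit ball. What is left is Hoelder's inequality for \<open>V y\<close>.\<close>
  have weak: "weak_norm ?q (dual_space Y) xs \<le> ennreal \<sigma>"
    unfolding weak_norm_def
  proof (rule SUP_least)
    fix f assume f: "f \<in> dual_ball (dual_space Y)"
    then have fo: "f \<in> operators (dual_space Y) real_space"
      by (auto simp: dual_ball_def intro: dual_opsD(1))
    show "seq_norm ?q (\<lambda>j. f (xs j)) \<le> ennreal \<sigma>"
    proof (rule seq_norm_conj_le[OF p \<sigma>, of N])
      show "f (xs j) = 0" if "N \<le> j" for j
        using that operator_zero[OF D.pre_normed_axioms real_space.pre_normed_axioms fo]
        by (simp add: xs_def) (simp add: real_space_def)
      fix b :: "nat \<Rightarrow> real"
      let ?B = "(\<Sum>j<N. \<bar>b j\<bar> powr P) powr (1 / P)"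
      have "\<bar>\<Sum>j<N. b j * f (xs j)\<bar> \<le> \<sigma> * ?B"
      proof (rule dual_ball_combination[OF Y.pre_normed_axioms f xs_dual])
        fix y assume y: "y \<in> vcar Y" "vnorm Y y \<le> 1"
        have "\<bar>\<Sum>j<N. b j * xs j y\<bar> = \<bar>\<Sum>j<N. b j * (?\<mu> j powr (- 1 / P) * (\<integral>x. indicator (A j) x * V y x \<partial>M))\<bar>"
          using y by (simp add: xs_def \<phi>_def)
        also have "\<dots> \<le> Lq_norm M ?q (V y) * ?B"
          unfolding P(1) by (rule partition_functional_bound[OF P(2) disj A]) (use V(1)[OF y(1)] P(1) in auto)
        also have "\<dots> \<le> \<sigma> * ?B"
          using V_norm[OF y(1)] mult_left_mono[OF y(2) \<sigma>] by (intro mult_right_mono) auto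
        finally show "\<bar>\<Sum>j<N. b j * xs j y\<bar> \<le> \<sigma> * ?B" .
      qed
      then show "\<bar>\<Sum>j<N. b j * f (xs j)\<bar> \<le> \<sigma> * (\<Sum>j<N. \<bar>b j\<bar> powr real_of_ereal p) powr (1 / real_of_ereal p)"
        by (simp add: P(1))
    qed
  qed
  let ?C = "\<rho> * (1 + e)"
  have C: "0 \<le> ?C" using \<rho> e by simp
  have strong: "strong_norm p F u \<le> ennreal ?C"
  proof -
    have u_norm: "vnorm F (u j) powr P \<le> ?\<mu> j * ?C powr P" if j: "j < N" for j
    proof -
      have "vnorm F (R (ae_class M (w j))) \<le> \<rho> * vnorm (Lq M 1) (ae_class M (w j))"
        unfolding \<rho>_def by (rule opnorm_bound[OF L1.pre_normed_axioms F.pre_normed_axioms R wL[OF j]])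
      also have "\<dots> \<le> ?C"
        using w(2)[OF j] \<rho> borel_measurable_integrable[OF w(1)[OF j]]
        by (simp add: vnorm_ae_class Lq_norm_1 mult_left_mono)
      finally have "vnorm F (u j) \<le> ?\<mu> j powr (1 / P) * ?C"
        using j by (simp add: u_def F.norm_scale Rw mult_left_mono)
      then have "vnorm F (u j) powr P \<le> (?\<mu> j powr (1 / P) * ?C) powr P"
        using F.norm_nonneg[OF u_in] P by (intro powr_mono2) auto
      also have "\<dots> = ?\<mu> j * ?C powr P" using C P by (simp add: powr_mult powr_powr)
      finally show ?thesis .
    qed
    define s where "s = (\<Sum>j<N. vnorm F (u j) powr P)"
    have "(\<lambda>j. vnorm F (u j) powr P) sums s"
      unfolding s_def by (rule sums_finite) (auto simp: u_def F.norm_zero)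
    then have sums: "(\<lambda>j. \<bar>vnorm F (u j)\<bar> powr P) sums s" using F.norm_nonneg[OF u_in] by simp
    have "s \<le> (\<Sum>j<N. ?\<mu> j * ?C powr P)" unfolding s_def by (intro sum_mono u_norm) simp
    also have "\<dots> = (\<Sum>j<N. ?\<mu> j) * ?C powr P" by (simp add: sum_distrib_right)
    also have "(\<Sum>j<N. ?\<mu> j) = measure M (space M)"
      unfolding cover using A disj by (intro finite_measure_finite_Union[symmetric]) auto
    finally have "s \<le> ?C powr P" by (simp add: prob_space)
    moreover have "0 \<le> s" unfolding s_def by (intro sum_nonneg) auto
    ultimately have "s powr (1 / P) \<le> (?C powr P) powr (1 / P)" using P by (intro powr_mono2) auto
    also have "\<dots> = ?C" using C P by (simp add: powr_powr)
    finally show ?thesis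
      using sums by (simp add: strong_norm_def seq_norm_def P(1) sums_iff ennreal_leI)
  qed
  show ?thesis
  proof (rule that)
    show "pos_nuclear_rep p Y F (R \<circ> Lq_incl \<circ> S) xs u"
      unfolding pos_nuclear_rep_def
      using xs_pos u_in lim le_less_trans[OF weak] le_less_trans[OF strong] by (auto simp: less_top)
    have "weak_norm ?q (dual_space Y) xs * strong_norm p F u \<le> ennreal \<sigma> * ennreal ?C"
      by (intro mult_mono weak strong) auto
    also have "\<dots> = ennreal (?C * \<sigma>)" using \<sigma> C by (simp add: ennreal_mult[symmetric] mult.commute)
    finally show "weak_norm ?q (dual_space Y) xs * strong_norm p F u
      \<le> ennreal (opnorm (Lq M 1) F R * (1 + e) * opnorm Y (Lq M ?q) S)"
      by (simp only: \<sigma>_def \<rho>_def)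
  qed
qed

text \<open>The nuclear norm is an infimum over representations, so letting e tend to zero removes
  the factor \<open>1 + e\<close>, even if no single representation attains the bound.\<close>

lemma pos_integral_bound_Lq_incl:
  assumes p: "1 \<le> p" "p < \<infinity>"
  shows "pos_integral_bound TYPE('y) TYPE('f) p (Lq M (conj_exp p)) (Lq M 1) Lq_incl 1"
  unfolding pos_integral_bound_def
proof (intro allI impI)
  fix Y :: "'y nlattice" and F :: "'f nspace" and S R
  assume Y: "banach_lattice Y" and F: "banach_space F"
    and S: "S \<in> operators Y (Lq M (conj_exp p))" "positive_op Y (Lq M (conj_exp p)) S"
      "finite_rank Y (Lq M (conj_exp p)) S"
    and R: "R \<in> operators (Lq M 1) F" "finite_rank (Lq M 1) F R"
  let ?T = "R \<circ> Lq_incl \<circ> S"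
  interpret Y: banach_lattice Y by fact
  interpret F: banach_space F by fact
  interpret LQ: pre_normed "Lq M (conj_exp p)" by (rule pre_normed_Lq[OF conj_exp_ge_1[OF p]])
  interpret L1: pre_normed "Lq M 1" by (rule pre_normed_Lq) simp
  note pn = Y.pre_normed_axioms F.pre_normed_axioms LQ.pre_normed_axioms L1.pre_normed_axioms
  define \<sigma> where "\<sigma> = opnorm Y (Lq M (conj_exp p)) S"
  define \<rho> where "\<rho> = opnorm (Lq M 1) F R"
  have \<sigma>\<rho>: "0 \<le> \<sigma>" "0 \<le> \<rho>" unfolding \<sigma>_def \<rho>_def by (auto intro: opnorm_nonneg pn S R)
  have bound: "pos_nuclear_norm p Y F ?T \<le> ennreal (\<rho> * (1 + e) * \<sigma>)" if e: "0 < e" for e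
  proof -
    obtain xs u where "pos_nuclear_rep p Y F ?T xs u"
      "weak_norm (conj_exp p) (dual_space Y) xs * strong_norm p F u \<le> ennreal (\<rho> * (1 + e) * \<sigma>)"
      unfolding \<sigma>_def \<rho>_def by (rule pos_nuclear_rep_near_optimal[OF p Y F S R(1) e])
    then show ?thesis unfolding pos_nuclear_norm_def by (blast intro: Inf_lower2)
  qed
  have "pos_nuclear_norm p Y F ?T \<le> ennreal (\<rho> * \<sigma>)"
  proof (rule ennreal_le_epsilon)
    fix d :: real assume d: "0 < d"
    \<comment> \<open>The 1 keeps the denominator positive when \<open>R\<close> or \<open>S\<close>
      has norm zero; in every case \<open>\<rho> * \<sigma> * e\<close> is at most
      \<open>d\<close>.\<close>
    define e where "e = d / (\<rho> * \<sigma> + 1)"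
    have "0 < \<rho> * \<sigma> + 1" using \<sigma>\<rho> by (simp add: add_nonneg_pos)
    then have e: "0 < e" "\<rho> * \<sigma> * e \<le> d" using d \<sigma>\<rho> by (auto simp: e_def field_simps)
    have "pos_nuclear_norm p Y F ?T \<le> ennreal (\<rho> * (1 + e) * \<sigma>)" by (rule bound[OF e(1)])
    also have "\<dots> \<le> ennreal (\<rho> * \<sigma> + d)" using e(2) by (intro ennreal_leI) (simp add: algebra_simps)
    also have "\<dots> = ennreal (\<rho> * \<sigma>) + ennreal d" using \<sigma>\<rho> d by simp
    finally show "pos_nuclear_norm p Y F ?T \<le> ennreal (\<rho> * \<sigma>) + ennreal d" .
  qed
  moreover have "pos_nuclear p Y F ?T"
  proof -
    have "?T \<in> operators Y F"
      by (rule operators_comp[OF pn(1,3,2) S(1) operators_comp[OF pn(3,4,2) Lq_incl_operator[OF p] R(1)]])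
    \<comment> \<open>Any tolerance serves for mere existence; 1 is taken.\<close>
    moreover obtain xs u where "pos_nuclear_rep p Y F ?T xs u"
      by (rule pos_nuclear_rep_near_optimal[OF p Y F S R(1) zero_less_one])
    ultimately show ?thesis unfolding pos_nuclear_def by blast
  qed
  ultimately show "pos_nuclear p Y F ?T \<and> pos_nuclear_norm p Y F ?T
    \<le> ennreal (1 * opnorm (Lq M 1) F R * opnorm Y (Lq M (conj_exp p)) S)"
    by (simp add: \<sigma>_def \<rho>_def)
qed

end

theorem theorem3p12:
  fixes M :: "'a measure" and p :: ereal
  assumes "prob_space M" and "1 \<le> p" and "p < \<infinity>"
  shows "pos_integral TYPE('y) TYPE('f) p (Lq M (conj_exp p)) (Lq M 1) Lq_incl \<and>
    pos_integral_norm TYPE('y) TYPE('f) p (Lq M (conj_exp p)) (Lq M 1) Lq_incl \<le> 1"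
proof
  interpret prob_space M by fact
  \<comment> \<open>The constant 1 serves twice: as the positive constant of integrality and as a
    member of the set whose infimum is the norm.\<close>
  have bound: "pos_integral_bound TYPE('y) TYPE('f) p (Lq M (conj_exp p)) (Lq M 1) Lq_incl 1"
    by (rule pos_integral_bound_Lq_incl[OF assms(2,3)])
  show "pos_integral TYPE('y) TYPE('f) p (Lq M (conj_exp p)) (Lq M 1) Lq_incl"
    unfolding pos_integral_def using bound Lq_incl_operator[OF assms(2,3)] zero_less_one by blast
  have "pos_integral_norm TYPE('y) TYPE('f) p (Lq M (conj_exp p)) (Lq M 1) Lq_incl \<le> ennreal 1"
    unfolding pos_integral_norm_def using bound by (intro INF_lower) simp
  then show "pos_integral_norm TYPE('y) TYPE('f) p (Lq M (conj_exp p)) (Lq M 1) Lq_incl \<le> 1"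
    by simp
qed

end
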